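(* Let $W_{\psi,\varphi}$ be an unbounded weighted composition operator on $\mathcal F^2$ induced by entire functions $\psi,\varphi$ with $\psi\not\equiv0$. Then $W_{\psi,\varphi}$ is Hermitian if and only if the following two conditions hold. (1) $W_{\psi,\varphi}=W_{\psi,\varphi,\max}$. (2) There are $A\in\mathbb R$, $C\in\mathbb R\setminus\{0\}$ and $B\in\mathbb C$ such that $\varphi(z)=Az+B$ and $\psi(z)=Ce^{\overline Bz}$.
   Context: The Fock space $\mathcal F^2$ is the Hilbert space of entire functions on $\mathbb C$ that are square integrable with respect to $\frac1\pi e^{-|z|^2}\,dV(z)$ ($dV$ is Lebesgue measure on $\mathbb C$), with inner product $\langle f,g\rangle=\frac1\pi\int_{\mathbb C}f(z)\overline{g(z)}e^{-|z|^2}\,dV(z)$. For entire functions $\psi,\varphi$, put $E(\psi,\varphi)f=\psi\cdot (f\circ\varphi)$. The maximal weighted composition operator $W_{\psi,\varphi,\max}$ has domain $\{f\in\mathcal F^2: E(\psi,\varphi)f\in\mathcal F^2\}$ and acts by $W_{\psi,\varphi,\max}f=E(\psi,\varphi)f$. An unbounded weighted composition operator $W_{\psi,\varphi}$ is the restriction of $W_{\psi,\varphi,\max}$ to some linear subspace $\operatorname{dom}(W_{\psi,\varphi})$ of $\operatorname{dom}(W_{\psi,\varphi,\max})$ ("unbounded" means not necessarily bounded). A closed densely defined operator $T$ is Hermitian if $T=T^*$ (including equality of domains). *)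

theory Defs
  imports "HOL-Complex_Analysis.Complex_Analysis"
begin

definition fock :: "(complex \<Rightarrow> complex) set" where
  "fock = {f. f holomorphic_on UNIV \<and>
     integrable lborel (\<lambda>z::complex. 1 / pi * (norm (f z))\<^sup>2 * exp (- (norm z)\<^sup>2))}"

definition fock_inner :: "(complex \<Rightarrow> complex) \<Rightarrow> (complex \<Rightarrow> complex) \<Rightarrow> complex" where
  "fock_inner f g =
     of_real (1 / pi) * (LINT z|lborel. f z * cnj (g z) * of_real (exp (- (norm z)\<^sup>2)))"

definition fock_norm :: "(complex \<Rightarrow> complex) \<Rightarrow> real" where
  "fock_norm f = sqrt (Re (fock_inner f f))"

definition fun_subspace :: "(complex \<Rightarrow> complex) set \<Rightarrow> bool" where
  "fun_subspace D \<longleftrightarrow>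
     (\<lambda>z. 0) \<in> D \<and>
     (\<forall>f\<in>D. \<forall>g\<in>D. (\<lambda>z. f z + g z) \<in> D) \<and>
     (\<forall>c. \<forall>f\<in>D. (\<lambda>z. c * f z) \<in> D)"

text \<open>
  A (not necessarily bounded, not necessarily everywhere defined) operator is represented by its
  graph, so that equality of operators is equality of graphs and includes equality of domains.
\<close>

type_synonym fock_op = "((complex \<Rightarrow> complex) \<times> (complex \<Rightarrow> complex)) set"

definition linear_fock_op :: "fock_op \<Rightarrow> bool" where
  "linear_fock_op T \<longleftrightarrow>
     T \<subseteq> fock \<times> fock \<and> single_valued T \<and> fun_subspace (Domain T) \<and>
     (\<forall>f f' g g'. (f, f') \<in> T \<longrightarrow> (g, g') \<in> T \<longrightarrow> ((\<lambda>z. f z + g z), (\<lambda>z. f' z + g' z)) \<in> T) \<and>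
     (\<forall>c f f'. (f, f') \<in> T \<longrightarrow> ((\<lambda>z. c * f z), (\<lambda>z. c * f' z)) \<in> T)"

definition densely_defined :: "fock_op \<Rightarrow> bool" where
  "densely_defined T \<longleftrightarrow>
     (\<forall>f\<in>fock. \<forall>e>0. \<exists>g\<in>Domain T. fock_norm (\<lambda>z. f z - g z) < e)"

definition closed_op :: "fock_op \<Rightarrow> bool" where
  "closed_op T \<longleftrightarrow>
     (\<forall>u v f g. (\<forall>n::nat. (u n, v n) \<in> T) \<longrightarrow> f \<in> fock \<longrightarrow> g \<in> fock \<longrightarrow>
        (\<lambda>n. fock_norm (\<lambda>z. u n z - f z)) \<longlonglongrightarrow> 0 \<longrightarrow>
        (\<lambda>n. fock_norm (\<lambda>z. v n z - g z)) \<longlonglongrightarrow> 0 \<longrightarrow>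
        (f, g) \<in> T)"

text \<open>The graph of \<open>T\<^sup>*\<close>; it is single-valued exactly when \<open>T\<close> is densely defined.\<close>

definition adjoint_op :: "fock_op \<Rightarrow> fock_op" where
  "adjoint_op T =
     {(g, h). g \<in> fock \<and> h \<in> fock \<and> (\<forall>(f, f')\<in>T. fock_inner f' g = fock_inner f h)}"

definition hermitian_op :: "fock_op \<Rightarrow> bool" where
  "hermitian_op T \<longleftrightarrow>
     linear_fock_op T \<and> closed_op T \<and> densely_defined T \<and> T = adjoint_op T"

definition wco_expr ::
  "(complex \<Rightarrow> complex) \<Rightarrow> (complex \<Rightarrow> complex) \<Rightarrow> (complex \<Rightarrow> complex) \<Rightarrow> complex \<Rightarrow> complex" where
  "wco_expr \<psi> \<phi> f = (\<lambda>z. \<psi> z * f (\<phi> z))"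

definition wco_max :: "(complex \<Rightarrow> complex) \<Rightarrow> (complex \<Rightarrow> complex) \<Rightarrow> fock_op" where
  "wco_max \<psi> \<phi> = {(f, wco_expr \<psi> \<phi> f) |f. f \<in> fock \<and> wco_expr \<psi> \<phi> f \<in> fock}"

definition unbounded_wco :: "(complex \<Rightarrow> complex) \<Rightarrow> (complex \<Rightarrow> complex) \<Rightarrow> fock_op \<Rightarrow> bool" where
  "unbounded_wco \<psi> \<phi> W \<longleftrightarrow>
     (\<exists>D. fun_subspace D \<and> D \<subseteq> Domain (wco_max \<psi> \<phi>) \<and> W = wco_max \<psi> \<phi> \<inter> (D \<times> UNIV))"

end

theory Submission
  imports Defs "HOL-Probability.Distributions" "HOL-Real_Asymp.Real_Asymp"
begin

text \<open>
  Testing \<open>W\<^sup>* = W\<close> on the reproducing kernels \<open>K\<^sub>w z = exp (cnj w * z)\<close> gives the identity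
  \<open>\<psi> z * exp (cnj w * \<phi> z) = cnj (\<psi> w) * exp (cnj (\<phi> w) * z)\<close>, which forces the stated form
  of \<open>\<phi>\<close> and \<open>\<psi>\<close>; conversely it also yields \<open>W\<^sub>m\<^sub>a\<^sub>x\<^sup>* \<subseteq> W\<^sub>m\<^sub>a\<^sub>x\<close>.  Everything else reduces to the
  symmetry of \<open>W\<^sub>m\<^sub>a\<^sub>x\<close> on its full domain.  If \<open>A \<noteq> 1\<close>, a Weyl translation moves the fixed point of
  \<open>\<phi>\<close> to the origin and turns the operator into a multiple of \<open>f z \<mapsto> f (A * z)\<close>, for which
  averaging over rotations and Parseval's identity on circles give symmetry.  If \<open>A = 1\<close>, a rotation makes
  \<open>B = 2 * s\<close> real and non-negative, and the two inner products become, for each fixed real part, the integrals of one entire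
  function over the lines \<open>Re \<zeta> = s\<close> and \<open>Re \<zeta> = - s\<close>; the pointwise bound
  \<open>\<bar>f z\<bar> \<le> \<parallel>f\<parallel> * exp (\<bar>z\<bar>\<^sup>2 / 2)\<close> makes that function bounded on the strip between them, so the line of
  integration can be shifted.
\<close>

section \<open>Lebesgue measure on the complex plane\<close>

lemma measurable_Complex_pair [measurable]:
  "(\<lambda>(x, y). Complex x y) \<in> borel_measurable (lborel \<Otimes>\<^sub>M lborel)"
  unfolding Complex_eq by measurable

text \<open>Lebesgue measure is determined by its values on boxes, and a box in the plane is a
  product of intervals in the two coordinates. This makes Fubini's theorem available in real and
  imaginary parts.\<close>

lemma lborel_complex_eq:
  "(lborel :: complex measure) = distr (lborel \<Otimes>\<^sub>M lborel) borel (\<lambda>(x, y). Complex x y)"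
proof (rule lborel_eqI)
  fix l u :: complex
  assume le: "\<And>b. b \<in> Basis \<Longrightarrow> l \<bullet> b \<le> u \<bullet> b"
  have le': "Re l \<le> Re u" "Im l \<le> Im u"
    using le[of 1] le[of \<i>] by auto
  have "emeasure (distr (lborel \<Otimes>\<^sub>M lborel) borel (\<lambda>(x, y). Complex x y)) (box l u)
      = emeasure (lborel \<Otimes>\<^sub>M lborel) ({Re l<..<Re u} \<times> {Im l<..<Im u})"
    by (subst emeasure_distr)
       (auto simp: in_box_complex_iff intro!: arg_cong2[where f=emeasure] simp: space_pair_measure)
  also have "\<dots> = ennreal (Re u - Re l) * ennreal (Im u - Im l)"
    using le' by (subst lborel.emeasure_pair_measure_Times) auto
  also have "\<dots> = ennreal (\<Prod>b\<in>Basis. (u - l) \<bullet> b)"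
    using le' by (simp add: Basis_complex_def ennreal_mult)
  finally show "emeasure (distr (lborel \<Otimes>\<^sub>M lborel) borel (\<lambda>(x, y). Complex x y)) (box l u)
      = ennreal (\<Prod>b\<in>Basis. (u - l) \<bullet> b)" .
qed simp

lemma nn_integral_lborel_complex:
  assumes [measurable]: "F \<in> borel_measurable borel"
  shows "(\<integral>\<^sup>+z. F z \<partial>lborel) = (\<integral>\<^sup>+x. \<integral>\<^sup>+y. F (Complex x y) \<partial>lborel \<partial>lborel)"
proof -
  have "(\<integral>\<^sup>+z. F z \<partial>lborel) = (\<integral>\<^sup>+p. F (case p of (x, y) \<Rightarrow> Complex x y) \<partial>(lborel \<Otimes>\<^sub>M lborel))"
    by (subst lborel_complex_eq, subst nn_integral_distr) auto
  also have "\<dots> = (\<integral>\<^sup>+x. \<integral>\<^sup>+y. F (Complex x y) \<partial>lborel \<partial>lborel)"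
    by (subst lborel.nn_integral_fst[symmetric]) auto
  finally show ?thesis .
qed

lemma integral_lborel_complex:
  fixes F :: "complex \<Rightarrow> 'a::{banach, second_countable_topology}"
  assumes "integrable lborel F"
  shows "AE x in lborel. integrable lborel (\<lambda>y. F (Complex x y))"
    and "integrable lborel (\<lambda>x. \<integral>y. F (Complex x y) \<partial>lborel)"
    and "(\<integral>z. F z \<partial>lborel) = (\<integral>x. \<integral>y. F (Complex x y) \<partial>lborel \<partial>lborel)"
proof -
  have [measurable]: "F \<in> borel_measurable borel"
    using assms by auto
  have I: "integrable (lborel \<Otimes>\<^sub>M lborel) (\<lambda>p. F (case p of (x, y) \<Rightarrow> Complex x y))"
    using assms by (subst (asm) lborel_complex_eq, subst (asm) integrable_distr_eq) auto
  show "AE x in lborel. integrable lborel (\<lambda>y. F (Complex x y))"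
    using lborel_pair.AE_integrable_fst'[OF I] by simp
  show "integrable lborel (\<lambda>x. \<integral>y. F (Complex x y) \<partial>lborel)"
    using lborel_pair.integrable_fst'[OF I] by simp
  have "(\<integral>z. F z \<partial>lborel) = (\<integral>p. F (case p of (x, y) \<Rightarrow> Complex x y) \<partial>(lborel \<Otimes>\<^sub>M lborel))"
    by (subst lborel_complex_eq, subst integral_distr) auto
  also have "\<dots> = (\<integral>x. \<integral>y. F (Complex x y) \<partial>lborel \<partial>lborel)"
    using lborel_pair.integral_fst'[OF I] by simp
  finally show "(\<integral>z. F z \<partial>lborel) = (\<integral>x. \<integral>y. F (Complex x y) \<partial>lborel \<partial>lborel)" .
qed

section \<open>Shears and rotations preserve area\<close>

lemma distr_lborel_shear_Re:
  "distr lborel borel (\<lambda>z. z + of_real (t * Im z)) = (lborel :: complex measure)"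
proof (rule measure_eqI)
  fix A assume "A \<in> sets (distr lborel borel (\<lambda>z. z + of_real (t * Im z)) :: complex measure)"
  then have [measurable]: "A \<in> sets borel" by simp
  have [measurable]: "(\<lambda>(x, y). indicator A (Complex x y + complex_of_real (t * y)) :: ennreal)
      \<in> borel_measurable (lborel \<Otimes>\<^sub>M lborel)"
    unfolding Complex_eq by measurable
  have [measurable]: "(\<lambda>x. indicator A (Complex x y) :: ennreal) \<in> borel_measurable borel" for y
    unfolding Complex_eq by measurable
  have "emeasure (distr lborel borel (\<lambda>z. z + of_real (t * Im z))) A
      = (\<integral>\<^sup>+z. indicator A (z + of_real (t * Im z)) \<partial>lborel)"
    by (simp flip: nn_integral_indicator add: nn_integral_distr)
  also have "\<dots> = (\<integral>\<^sup>+x. \<integral>\<^sup>+y. indicator A (Complex x y + complex_of_real (t * y)) \<partial>lborel \<partial>lborel)"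
    by (subst nn_integral_lborel_complex) auto
  \<comment> \<open>The swap makes the real part the inner variable; for fixed \<open>y\<close> the
    shear is then the translation of \<open>x\<close> by \<open>t * y\<close>.\<close>
  also have "\<dots> = (\<integral>\<^sup>+y. \<integral>\<^sup>+x. indicator A (Complex x y + complex_of_real (t * y)) \<partial>lborel \<partial>lborel)"
    by (rule lborel_pair.Fubini'[symmetric]) simp
  also have "\<dots> = (\<integral>\<^sup>+y. \<integral>\<^sup>+x. indicator A (Complex x y) \<partial>lborel \<partial>lborel)"
  proof (rule nn_integral_cong)
    fix y
    show "(\<integral>\<^sup>+x. indicator A (Complex x y + complex_of_real (t * y)) \<partial>lborel)
        = (\<integral>\<^sup>+x. indicator A (Complex x y) \<partial>lborel)"
      using nn_integral_real_affine[of "\<lambda>x. indicator A (Complex x y)" 1 "t * y"]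
      by (simp add: Complex_eq algebra_simps)
  qed
  also have "\<dots> = (\<integral>\<^sup>+x. \<integral>\<^sup>+y. indicator A (Complex x y) \<partial>lborel \<partial>lborel)"
    by (rule lborel_pair.Fubini') (simp add: Complex_eq split_def)
  also have "\<dots> = (\<integral>\<^sup>+z. indicator A z \<partial>lborel)"
    by (rule nn_integral_lborel_complex[symmetric]) simp
  finally show "emeasure (distr lborel borel (\<lambda>z. z + of_real (t * Im z))) A = emeasure lborel A"
    by simp
qed simp

lemma distr_lborel_shear_Im:
  "distr lborel borel (\<lambda>z. z + \<i> * of_real (s * Re z)) = (lborel :: complex measure)"
proof (rule measure_eqI)
  fix A assume "A \<in> sets (distr lborel borel (\<lambda>z. z + \<i> * of_real (s * Re z)) :: complex measure)"
  then have [measurable]: "A \<in> sets borel" by simp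
  have [measurable]: "(\<lambda>y. indicator A (Complex x y) :: ennreal) \<in> borel_measurable borel" for x
    unfolding Complex_eq by measurable
  have "emeasure (distr lborel borel (\<lambda>z. z + \<i> * of_real (s * Re z))) A
      = (\<integral>\<^sup>+z. indicator A (z + \<i> * of_real (s * Re z)) \<partial>lborel)"
    by (simp flip: nn_integral_indicator add: nn_integral_distr)
  also have "\<dots> = (\<integral>\<^sup>+x. \<integral>\<^sup>+y. indicator A (Complex x y + \<i> * complex_of_real (s * x)) \<partial>lborel \<partial>lborel)"
    by (subst nn_integral_lborel_complex) auto
  also have "\<dots> = (\<integral>\<^sup>+x. \<integral>\<^sup>+y. indicator A (Complex x y) \<partial>lborel \<partial>lborel)"
  proof (rule nn_integral_cong)
    fix x
    show "(\<integral>\<^sup>+y. indicator A (Complex x y + \<i> * complex_of_real (s * x)) \<partial>lborel)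
        = (\<integral>\<^sup>+y. indicator A (Complex x y) \<partial>lborel)"
      using nn_integral_real_affine[of "\<lambda>y. indicator A (Complex x y)" 1 "s * x"]
      by (simp add: Complex_eq algebra_simps)
  qed
  also have "\<dots> = (\<integral>\<^sup>+z. indicator A z \<partial>lborel)"
    by (rule nn_integral_lborel_complex[symmetric]) simp
  finally show "emeasure (distr lborel borel (\<lambda>z. z + \<i> * of_real (s * Re z))) A = emeasure lborel A"
    by simp
qed simp

text \<open>A rotation that is not the identity or a half-turn is a product of three shears.\<close>

lemma distr_lborel_rotation:
  fixes \<zeta> :: complex
  assumes "norm \<zeta> = 1"
  shows "distr lborel borel ((*) \<zeta>) = lborel"
proof -
  have main: "distr lborel borel ((*) \<xi>) = lborel" if \<xi>: "norm \<xi> = 1" "Im \<xi> \<noteq> 0" for \<xi> :: complex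
  proof -
    \<comment> \<open>The product of the shears \<open>H\<close>, \<open>V\<close>, \<open>H\<close>
      has diagonal entries \<open>1 + t * s\<close> and off-diagonal entries
      \<open>t * (2 + t * s)\<close> and \<open>s\<close>. Matching the diagonal with
      \<open>c\<close> forces this \<open>t\<close>, and then \<open>c * c + s * s = 1\<close> gives
      the remaining entry \<open>- s\<close>.\<close>
    define c s t where "c = Re \<xi>" and "s = Im \<xi>" and "t = (c - 1) / s"
    have s: "s \<noteq> 0" using \<xi> by (simp add: s_def)
    have cs: "c * c + s * s = 1"
      using \<xi> by (simp add: c_def s_def cmod_def power2_eq_square)
    define H V where "H = (\<lambda>z. z + complex_of_real (t * Im z))"
      and "V = (\<lambda>z. z + \<i> * complex_of_real (s * Re z))"
    have [measurable]: "H \<in> borel_measurable borel" "V \<in> borel_measurable borel"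
      unfolding H_def V_def by measurable
    have ts: "t * s = c - 1" using s by (simp add: t_def)
    have "t * (2 + t * s) = t * (c + 1)"
      by (simp add: ts)
    also have "\<dots> = (c * c - 1) / s"
      by (simp add: t_def field_simps)
    also have "\<dots> = - s" using s cs by (simp add: field_simps)
    finally have t2: "t * (2 + t * s) = - s" .
    have "H (V (H z)) = \<xi> * z" for z
    proof (rule complex_eqI)
      have "Re (H (V (H z))) = (1 + t * s) * Re z + t * (2 + t * s) * Im z"
        by (simp add: H_def V_def algebra_simps)
      then show "Re (H (V (H z))) = Re (\<xi> * z)"
        using ts t2 by (simp add: c_def s_def)
      have "Im (H (V (H z))) = s * Re z + (1 + t * s) * Im z"
        by (simp add: H_def V_def algebra_simps)
      then show "Im (H (V (H z))) = Im (\<xi> * z)"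
        using ts by (simp add: c_def s_def)
    qed
    then have "((*) \<xi>) = H \<circ> (V \<circ> H)" by auto
    then have "distr lborel borel ((*) \<xi>) = distr (distr (distr lborel borel H) borel V) borel H"
      by (simp add: distr_distr comp_assoc)
    also have "\<dots> = lborel"
      using distr_lborel_shear_Re[of t] distr_lborel_shear_Im[of s] by (simp add: H_def V_def)
    finally show ?thesis .
  qed
  show ?thesis
  proof (cases "Im \<zeta> = 0")
    case False
    with assms show ?thesis by (rule main)
  next
    case True
    with assms have "\<zeta> = 1 \<or> \<zeta> = -1"
      by (auto simp: complex_eq_iff cmod_def)
    then show ?thesis
    proof
      assume "\<zeta> = 1"
      then have "((*) \<zeta>) = (\<lambda>z. z)" by auto
      then show ?thesis by (simp add: distr_id2)
    next
      assume "\<zeta> = -1"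
      \<comment> \<open>The half-turn has \<open>Im \<zeta> = 0\<close>, which excludes the shear
        formula, but it is the square of the quarter-turn, which the formula covers.\<close>
      then have "((*) \<zeta>) = (*) \<i> \<circ> (*) \<i>" by (auto simp: fun_eq_iff)
      then have "distr lborel borel ((*) \<zeta>) = distr (distr lborel borel ((*) \<i>)) borel ((*) \<i>)"
        by (simp add: distr_distr)
      also have "\<dots> = lborel" using main[of \<i>] by simp
      finally show ?thesis .
    qed
  qed
qed

lemma
  fixes F :: "complex \<Rightarrow> 'a::{banach, second_countable_topology}"
  assumes "norm \<zeta> = 1" and [measurable]: "F \<in> borel_measurable borel"
  shows integrable_rotation: "integrable lborel (\<lambda>z. F (\<zeta> * z)) \<longleftrightarrow> integrable lborel F"
    and integral_rotation: "(\<integral>z. F (\<zeta> * z) \<partial>lborel) = (\<integral>z. F z \<partial>lborel)"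
proof -
  show "integrable lborel (\<lambda>z. F (\<zeta> * z)) \<longleftrightarrow> integrable lborel F"
    using integrable_distr_eq[of "(*) \<zeta>" lborel borel F] distr_lborel_rotation[OF assms(1)] by simp
  show "(\<integral>z. F (\<zeta> * z) \<partial>lborel) = (\<integral>z. F z \<partial>lborel)"
    using integral_distr[of "(*) \<zeta>" lborel borel F] distr_lborel_rotation[OF assms(1)] by simp
qed

lemma
  fixes F :: "complex \<Rightarrow> 'a::{banach, second_countable_topology}"
  assumes [measurable]: "F \<in> borel_measurable borel"
  shows integrable_translation: "integrable lborel (\<lambda>z. F (z + w)) \<longleftrightarrow> integrable lborel F"
    and integral_translation: "(\<integral>z. F (z + w) \<partial>lborel) = (\<integral>z. F z \<partial>lborel)"
proof -
  show "integrable lborel (\<lambda>z. F (z + w)) \<longleftrightarrow> integrable lborel F"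
    using integrable_distr_eq[of "(+) w" lborel borel F] lborel_distr_plus[of w]
    by (simp add: add.commute)
  show "(\<integral>z. F (z + w) \<partial>lborel) = (\<integral>z. F z \<partial>lborel)"
    using integral_distr[of "(+) w" lborel borel F] lborel_distr_plus[of w] by (simp add: add.commute)
qed

text \<open>The Gaussian splits into a product over the two coordinates, each contributing
  \<open>sqrt pi\<close>.\<close>

lemma has_bochner_integral_complex_gaussian:
  "has_bochner_integral lborel (\<lambda>z::complex. exp (- (norm z)\<^sup>2)) pi"
proof -
  have G: "has_bochner_integral lborel (\<lambda>x::real. exp (- x\<^sup>2)) (sqrt pi)"
    using has_bochner_integral_even_function[OF gaussian_moment_0] by simp
  have G': "(\<integral>\<^sup>+x. ennreal (exp (- x\<^sup>2)) \<partial>lborel) = ennreal (sqrt pi)"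
    using nn_integral_eq_integral[OF integrable.intros[OF G]] has_bochner_integral_integral_eq[OF G]
    by simp
  have "(\<integral>\<^sup>+z. ennreal (exp (- (norm z)\<^sup>2)) \<partial>(lborel :: complex measure))
      = (\<integral>\<^sup>+x. \<integral>\<^sup>+y. ennreal (exp (- x\<^sup>2)) * ennreal (exp (- y\<^sup>2)) \<partial>lborel \<partial>lborel)"
    by (subst nn_integral_lborel_complex)
       (auto simp: cmod_def exp_add[symmetric] exp_diff[symmetric] ennreal_mult[symmetric])
  also have "\<dots> = ennreal (sqrt pi) * ennreal (sqrt pi)"
    by (simp add: nn_integral_cmult nn_integral_multc G')
  also have "\<dots> = ennreal pi"
    by (simp add: ennreal_mult[symmetric])
  finally have *: "(\<integral>\<^sup>+z. ennreal (exp (- (norm z)\<^sup>2)) \<partial>(lborel :: complex measure)) = ennreal pi" .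
  show ?thesis
    by (rule has_bochner_integral_nn_integral[OF _ _ _ *]) auto
qed

section \<open>The uniform probability measure on the unit interval\<close>

definition unit_unif :: "real measure" where
  "unit_unif = uniform_measure lborel {0..1}"

interpretation unit_unif: prob_space unit_unif
  unfolding unit_unif_def by (rule prob_space_uniform_measure) auto

lemma sets_unit_unif [measurable_cong, simp]: "sets unit_unif = sets borel"
  by (simp add: unit_unif_def)

lemma space_unit_unif [simp]: "space unit_unif = UNIV"
  by (simp add: unit_unif_def)

lemma measure_unit_unif_UNIV [simp]: "measure unit_unif UNIV = 1"
  using unit_unif.prob_space by simp

lemma unit_unif_eq_density: "unit_unif = density lborel (\<lambda>t. ennreal (indicator {0..1} t))"
  unfolding unit_unif_def uniform_measure_def
  by (rule arg_cong[where f = "density lborel"]) (auto simp: fun_eq_iff ennreal_indicator divide_ennreal_def)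

text \<open>Passing to the gauge integral allows the fundamental theorem of calculus to evaluate
  averages of characters.\<close>

lemma integral_unit_unif:
  fixes f :: "real \<Rightarrow> 'a::euclidean_space"
  assumes "continuous_on UNIV f"
  shows "(\<integral>t. f t \<partial>unit_unif) = integral {0..1} f"
proof -
  have [measurable]: "f \<in> borel_measurable borel"
    using assms by (rule borel_measurable_continuous_onI)
  have "(\<integral>t. f t \<partial>unit_unif) = (\<integral>t. indicator {0..1} t *\<^sub>R f t \<partial>lborel)"
    by (simp add: unit_unif_eq_density integral_density)
  also have "\<dots> = integral {0..1} f"
    using set_borel_integral_eq_integral(2)[OF borel_integrable_atLeastAtMost', of 0 1 f]
      continuous_on_subset[OF assms, of "{0..1}"]
    by (simp add: set_lebesgue_integral_def)
  finally show ?thesis .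
qed

section \<open>Means over circles\<close>

text \<open>The base point is \<open>z\<close> rather than its modulus, so the mean is again a
  function on the plane and can be integrated against area.\<close>

definition circle_mean :: "(complex \<Rightarrow> 'a::{banach, second_countable_topology}) \<Rightarrow> complex \<Rightarrow> 'a" where
  "circle_mean F z = (\<integral>t. F (cis (2 * pi * t) * z) \<partial>unit_unif)"

lemma measurable_cis [measurable]: "cis \<in> borel_measurable borel"
  by (intro borel_measurable_continuous_onI continuous_intros)

lemma measurable_cnj [measurable]: "cnj \<in> borel_measurable borel"
  by (intro borel_measurable_continuous_onI continuous_intros)

text \<open>By rotation invariance, each rotated copy of \<open>F\<close> has the same integral and
  the same integral of its norm, so Fubini's theorem exchanges the average with the area integral.
  Plane integrals can thus be compared circle by circle.\<close>

lemma
  fixes F :: "complex \<Rightarrow> 'a::{banach, second_countable_topology}"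
  assumes F: "integrable lborel F"
  shows integrable_circle_mean: "integrable lborel (circle_mean F)"
    and integral_circle_mean: "(\<integral>z. circle_mean F z \<partial>lborel) = (\<integral>z. F z \<partial>lborel)"
proof -
  have [measurable]: "F \<in> borel_measurable borel"
    using F by auto
  interpret pair_sigma_finite unit_unif "lborel :: complex measure" ..
  let ?G = "\<lambda>(t, z). F (cis (2 * pi * t) * z)"
  have I: "integrable (unit_unif \<Otimes>\<^sub>M lborel) ?G"
  proof (rule Fubini_integrable)
    show "?G \<in> borel_measurable (unit_unif \<Otimes>\<^sub>M lborel)"
      by measurable
    show "AE t in unit_unif. integrable lborel (\<lambda>z. ?G (t, z))"
      using F by (simp add: integrable_rotation)
    have "(\<integral>z. norm (?G (t, z)) \<partial>lborel) = (\<integral>z. norm (F z) \<partial>lborel)" for t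
      using integral_rotation[of "cis (2 * pi * t)" "\<lambda>z. norm (F z)"] by simp
    then show "integrable unit_unif (\<lambda>t. \<integral>z. norm (?G (t, z)) \<partial>lborel)"
      by (simp add: unit_unif.integrable_const)
  qed
  show "integrable lborel (circle_mean F)"
    unfolding circle_mean_def using integrable_snd[of "\<lambda>t z. F (cis (2 * pi * t) * z)"] I by simp
  have "(\<integral>z. circle_mean F z \<partial>lborel)
      = (\<integral>t. \<integral>z. F (cis (2 * pi * t) * z) \<partial>lborel \<partial>unit_unif)"
    unfolding circle_mean_def
    using Fubini_integral[of "\<lambda>t z. F (cis (2 * pi * t) * z)"] I by simp
  also have "\<dots> = (\<integral>z. F z \<partial>lborel)"
    by (simp add: integral_rotation)
  finally show "(\<integral>z. circle_mean F z \<partial>lborel) = (\<integral>z. F z \<partial>lborel)" .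
qed

text \<open>Orthonormality of the characters: for \<open>m \<noteq> n\<close> the antiderivative of
  \<open>cis (k * t)\<close> has equal values at 0 and 1, because \<open>k\<close> is an integer
  multiple of \<open>2 * pi\<close>.\<close>

lemma circle_mean_power:
  "(\<integral>t. cis (2 * pi * t) ^ m * cnj (cis (2 * pi * t) ^ n) \<partial>unit_unif) = (if m = n then 1 else 0)"
proof -
  define k where "k = 2 * pi * (real m - real n)"
  have eq: "cis (2 * pi * t) ^ m * cnj (cis (2 * pi * t) ^ n) = cis (k * t)" for t
    by (simp only: Complex.DeMoivre cis_cnj cis_mult k_def) (simp add: algebra_simps)
  show ?thesis
  proof (cases "m = n")
    case True
    then show ?thesis unfolding eq by (simp add: k_def)
  next
    case False
    then have k: "k \<noteq> 0" by (simp add: k_def)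
    have "((\<lambda>t. exp (\<i> * k * complex_of_real t) / (\<i> * k)) has_vector_derivative cis (k * t)) (at t within {0..1})" for t
    proof -
      have "((\<lambda>z. exp (\<i> * k * z) / (\<i> * k)) has_field_derivative exp (\<i> * k * of_real t)) (at (of_real t))"
        using k by (auto intro!: derivative_eq_intros)
      then show ?thesis
        by (subst cis_conv_exp) (use has_vector_derivative_real_field in \<open>force simp: mult.assoc\<close>)
    qed
    then have "((\<lambda>t. cis (k * t)) has_integral
        (exp (\<i> * k * complex_of_real 1) / (\<i> * k) - exp (\<i> * k * complex_of_real 0) / (\<i> * k))) {0..1}"
      by (intro fundamental_theorem_of_calculus) auto
    then have "((\<lambda>t. cis (k * t)) has_integral (cis k / (\<i> * k) - 1 / (\<i> * k))) {0..1}"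
      by (simp add: cis_conv_exp)
    moreover have "cis k = 1"
    proof -
      have "cis k = cis (2 * pi * real_of_int (int m - int n))"
        by (simp add: k_def)
      also have "\<dots> = 1"
        by (rule cis_multiple_2pi) auto
      finally show ?thesis .
    qed
    ultimately have "integral {0..1} (\<lambda>t. cis (k * t)) = 0"
      by (simp add: has_integral_iff)
    then show ?thesis
      using False unfolding eq by (subst integral_unit_unif) (auto intro!: continuous_intros)
  qed
qed

text \<open>The terms are dominated by the summable numbers \<open>norm (u n) * K\<close>, so sum
  and integral may be exchanged. Choosing \<open>h\<close> as a conjugate character extracts
  coefficients; choosing a conjugate entire function gives Parseval's identity.\<close>

lemma circle_fourier_sums:
  fixes u :: "nat \<Rightarrow> complex" and h :: "real \<Rightarrow> complex"
  assumes u: "summable (\<lambda>n. norm (u n))"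
    and h [measurable]: "h \<in> borel_measurable borel" and bd: "\<And>t. norm (h t) \<le> K"
  shows "(\<lambda>n. u n * (\<integral>t. cis (2 * pi * t) ^ n * h t \<partial>unit_unif)) sums
       (\<integral>t. (\<Sum>n. u n * cis (2 * pi * t) ^ n) * h t \<partial>unit_unif)"
proof -
  have K: "0 \<le> K" using order_trans[OF norm_ge_zero bd] .
  have nb: "norm (u n * cis (2 * pi * t) ^ n * h t) \<le> norm (u n) * K" for n t
    using bd[of t] by (simp add: norm_mult norm_power mult_left_mono)
  have I: "integrable unit_unif (\<lambda>t. u n * cis (2 * pi * t) ^ n * h t)" for n
    by (rule unit_unif.integrable_const_bound[where B = "norm (u n) * K"]) (auto simp: nb)
  have S: "summable (\<lambda>n. norm (u n) * K)"
    using u by (rule summable_mult2)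
  have "(\<lambda>n. \<integral>t. u n * cis (2 * pi * t) ^ n * h t \<partial>unit_unif) sums
       (\<integral>t. (\<Sum>n. u n * cis (2 * pi * t) ^ n * h t) \<partial>unit_unif)"
  proof (rule sums_integral[OF I])
    show "AE t in unit_unif. summable (\<lambda>n. norm (u n * cis (2 * pi * t) ^ n * h t))"
      by (intro AE_I2 summable_comparison_test'[OF S]) (use nb in auto)
    show "summable (\<lambda>n. \<integral>t. norm (u n * cis (2 * pi * t) ^ n * h t) \<partial>unit_unif)"
    proof (rule summable_comparison_test'[OF S])
      fix n
      have "(\<integral>t. norm (u n * cis (2 * pi * t) ^ n * h t) \<partial>unit_unif)
          \<le> (\<integral>t. norm (u n) * K \<partial>unit_unif)"
        by (intro integral_mono integrable_norm I unit_unif.integrable_const nb)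
      then show "norm (\<integral>t. norm (u n * cis (2 * pi * t) ^ n * h t) \<partial>unit_unif) \<le> norm (u n) * K"
        by (simp add:)
    qed
  qed
  moreover have "(\<Sum>n. u n * cis (2 * pi * t) ^ n * h t) = (\<Sum>n. u n * cis (2 * pi * t) ^ n) * h t" for t
    by (rule suminf_mult2[symmetric], rule summable_norm_cancel)
       (use u in \<open>simp add: norm_mult norm_power\<close>)
  ultimately show ?thesis
    by (simp add: mult.assoc)
qed

section \<open>Everywhere convergent power series on circles\<close>

lemma powser_everywhere_norm_summable:
  fixes a :: "nat \<Rightarrow> complex"
  assumes "\<And>z. (\<lambda>n. a n * z ^ n) sums f z"
  shows "summable (\<lambda>n. norm (a n * z ^ n))"
  \<comment> \<open>Convergence at a point of modulus strictly larger than \<open>norm z\<close>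
    gives absolute convergence at \<open>z\<close>.\<close>
  by (rule powser_insidea[of a "of_real (norm z + 1)"]) (use assms in \<open>auto simp: sums_iff\<close>)

lemma powser_everywhere_continuous:
  fixes a :: "nat \<Rightarrow> complex"
  assumes "\<And>z. (\<lambda>n. a n * z ^ n) sums f z"
  shows "continuous_on UNIV f"
proof -
  have "f = (\<lambda>z. \<Sum>n. a n * z ^ n)"
    using assms by (auto simp: sums_iff fun_eq_iff)
  moreover have "isCont (\<lambda>z. \<Sum>n. a n * z ^ n) z" for z
    using isCont_powser[of a "of_real (norm z + 1)" z] assms by (auto simp: sums_iff)
  ultimately show ?thesis
    by (simp add: continuous_at_imp_continuous_on)
qed

lemma continuous_on_circle_bounded:
  fixes f :: "complex \<Rightarrow> complex"
  assumes "continuous_on UNIV f"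
  obtains K where "\<And>t. norm (f (cis t * z)) \<le> K"
proof -
  have "compact (f ` sphere 0 (norm z))"
    using assms by (intro compact_continuous_image continuous_on_subset[OF assms]) auto
  then obtain K where "\<forall>x\<in>f ` sphere 0 (norm z). norm x \<le> K"
    using compact_imp_bounded bounded_iff by metis
  then have "norm (f (cis t * z)) \<le> K" for t
    by (auto simp: norm_mult)
  then show thesis by (rule that)
qed

text \<open>Integrating the series term by term against the conjugate of the \<open>m\<close>-th
  character leaves only its \<open>m\<close>-th term.\<close>

lemma powser_circle_coefficient:
  fixes a :: "nat \<Rightarrow> complex"
  assumes f: "\<And>z. (\<lambda>n. a n * z ^ n) sums f z"
  shows "(\<integral>t. f (cis (2 * pi * t) * z) * cnj (cis (2 * pi * t) ^ m) \<partial>unit_unif) = a m * z ^ m"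
proof -
  have "(\<lambda>n. (a n * z ^ n) * (\<integral>t. cis (2 * pi * t) ^ n * cnj (cis (2 * pi * t) ^ m) \<partial>unit_unif)) sums
       (\<integral>t. (\<Sum>n. (a n * z ^ n) * cis (2 * pi * t) ^ n) * cnj (cis (2 * pi * t) ^ m) \<partial>unit_unif)"
    by (rule circle_fourier_sums[OF powser_everywhere_norm_summable[OF f], of _ 1])
       (auto simp: norm_power)
  moreover have "(\<Sum>n. (a n * z ^ n) * cis (2 * pi * t) ^ n) = f (cis (2 * pi * t) * z)" for t
    using f[of "cis (2 * pi * t) * z"] by (simp add: sums_iff power_mult_distrib mult_ac)
  ultimately have "(\<lambda>n. (a n * z ^ n) * (if n = m then 1 else 0)) sums
       (\<integral>t. f (cis (2 * pi * t) * z) * cnj (cis (2 * pi * t) ^ m) \<partial>unit_unif)"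
    by (simp only: circle_mean_power)
  moreover have "(\<lambda>n. (a n * z ^ n) * (if n = m then 1 else 0)) sums (a m * z ^ m)"
    using sums_single[of m "\<lambda>n. a n * z ^ n"] by (simp add: if_distrib cong: if_cong)
  ultimately show ?thesis
    using sums_unique2 by blast
qed

lemma powser_circle_mean_value:
  fixes a :: "nat \<Rightarrow> complex"
  assumes f: "\<And>z. (\<lambda>n. a n * z ^ n) sums f z"
  shows "circle_mean f z = f 0"
proof -
  have "f 0 = a 0"
    using sums_unique2[OF f[of 0]] powser_sums_zero[of a] by blast
  then show ?thesis
    using powser_circle_coefficient[OF f, of z 0] by (simp add: circle_mean_def)
qed

text \<open>Only \<open>f\<close> is expanded; each character integrated against the conjugate of
  \<open>g\<close> returns a conjugate Taylor term of \<open>g\<close>. The dilation enters solely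
  through the factor \<open>A ^ n\<close>, which is what later makes real dilations
  symmetric.\<close>

lemma powser_circle_parseval:
  fixes a b :: "nat \<Rightarrow> complex" and A :: complex
  assumes f: "\<And>z. (\<lambda>n. a n * z ^ n) sums f z" and g: "\<And>z. (\<lambda>n. b n * z ^ n) sums g z"
  shows "(\<lambda>n. A ^ n * a n * cnj (b n) * (z * cnj z) ^ n) sums circle_mean (\<lambda>z. f (A * z) * cnj (g z)) z"
proof -
  have [measurable]: "g \<in> borel_measurable borel"
    using powser_everywhere_continuous[OF g] by (rule borel_measurable_continuous_onI)
  obtain K where K: "\<And>t. norm (g (cis t * z)) \<le> K"
    using continuous_on_circle_bounded[OF powser_everywhere_continuous[OF g]] by blast
  have "(\<lambda>n. (a n * (A * z) ^ n) * (\<integral>t. cis (2 * pi * t) ^ n * cnj (g (cis (2 * pi * t) * z)) \<partial>unit_unif)) sums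
       (\<integral>t. (\<Sum>n. (a n * (A * z) ^ n) * cis (2 * pi * t) ^ n) * cnj (g (cis (2 * pi * t) * z)) \<partial>unit_unif)"
    by (rule circle_fourier_sums[OF powser_everywhere_norm_summable[OF f], of _ K]) (auto simp: K)
  moreover have "(\<Sum>n. (a n * (A * z) ^ n) * cis (2 * pi * t) ^ n) = f (A * (cis (2 * pi * t) * z))" for t
    using f[of "A * (cis (2 * pi * t) * z)"] by (simp add: sums_iff power_mult_distrib mult_ac)
  moreover have "(\<integral>t. cis (2 * pi * t) ^ n * cnj (g (cis (2 * pi * t) * z)) \<partial>unit_unif) = cnj (b n * z ^ n)" for n
  proof -
    have "(\<integral>t. cis (2 * pi * t) ^ n * cnj (g (cis (2 * pi * t) * z)) \<partial>unit_unif)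
        = (\<integral>t. cnj (g (cis (2 * pi * t) * z) * cnj (cis (2 * pi * t) ^ n)) \<partial>unit_unif)"
      by (simp add: mult.commute)
    also have "\<dots> = cnj (\<integral>t. g (cis (2 * pi * t) * z) * cnj (cis (2 * pi * t) ^ n) \<partial>unit_unif)"
      by (rule Bochner_Integration.integral_cnj)
    finally show ?thesis
      by (simp only: powser_circle_coefficient[OF g])
  qed
  ultimately show ?thesis
    by (simp add: circle_mean_def power_mult_distrib mult_ac)
qed

section \<open>The Fock space and its reproducing kernel\<close>

lemma entire_powser:
  assumes "f holomorphic_on UNIV"
  shows "(\<lambda>n. (deriv ^^ n) f 0 / fact n * z ^ n) sums f z"
  using holomorphic_power_series[of f 0 "norm z + 1" z] holomorphic_on_subset[OF assms] by simp

lemma entire_measurable: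
  assumes "f holomorphic_on UNIV"
  shows "f \<in> borel_measurable borel"
  using holomorphic_on_imp_continuous_on[OF assms] by (rule borel_measurable_continuous_onI)

lemma entire_compose:
  assumes "f holomorphic_on UNIV" "g holomorphic_on UNIV"
  shows "(\<lambda>z. f (g z)) holomorphic_on UNIV"
  using holomorphic_on_compose_gen[OF assms(2,1)] by (simp add: o_def)

lemma fock_iff:
  "f \<in> fock \<longleftrightarrow> f holomorphic_on UNIV \<and> integrable lborel (\<lambda>z. (norm (f z))\<^sup>2 * exp (- (norm z)\<^sup>2))"
proof -
  have "(\<lambda>z. 1 / pi * (norm (f z))\<^sup>2 * exp (- (norm z)\<^sup>2))
      = (\<lambda>z. (1 / pi) * ((norm (f z))\<^sup>2 * exp (- (norm z)\<^sup>2)))"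
    by (simp add: mult.assoc)
  then show ?thesis
    unfolding fock_def by (auto simp del: times_divide_eq_left)
qed

lemma fock_entire: "f \<in> fock \<Longrightarrow> f holomorphic_on UNIV"
  by (simp add: fock_iff)

lemma fock_measurable: "f \<in> fock \<Longrightarrow> f \<in> borel_measurable borel"
  by (intro entire_measurable fock_entire)

lemma fock_scale:
  assumes "f \<in> fock"
  shows "(\<lambda>z. c * f z) \<in> fock"
  using assms by (auto simp: fock_iff norm_mult power_mult_distrib mult.assoc intro!: holomorphic_intros)

lemma fock_add:
  assumes "f \<in> fock" "g \<in> fock"
  shows "(\<lambda>z. f z + g z) \<in> fock"
  unfolding fock_iff
proof
  show "(\<lambda>z. f z + g z) holomorphic_on UNIV"
    using assms by (auto simp: fock_iff intro!: holomorphic_intros)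
  have [measurable]: "f \<in> borel_measurable borel" "g \<in> borel_measurable borel"
    using assms by (auto intro: fock_measurable)
  have "integrable lborel (\<lambda>z. 2 * ((norm (f z))\<^sup>2 * exp (- (norm z)\<^sup>2)) + 2 * ((norm (g z))\<^sup>2 * exp (- (norm z)\<^sup>2)))"
    using assms by (auto simp: fock_iff)
  then show "integrable lborel (\<lambda>z. (norm (f z + g z))\<^sup>2 * exp (- (norm z)\<^sup>2))"
  proof (rule Bochner_Integration.integrable_bound)
    show "AE z in lborel. norm ((norm (f z + g z))\<^sup>2 * exp (- (norm z)\<^sup>2))
      \<le> norm (2 * ((norm (f z))\<^sup>2 * exp (- (norm z)\<^sup>2)) + 2 * ((norm (g z))\<^sup>2 * exp (- (norm z)\<^sup>2)))"
    proof (rule AE_I2)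
      fix z
      have "(norm (f z + g z))\<^sup>2 \<le> (norm (f z) + norm (g z))\<^sup>2"
        by (intro power_mono norm_triangle_ineq) auto
      also have "\<dots> \<le> 2 * (norm (f z))\<^sup>2 + 2 * (norm (g z))\<^sup>2"
        using sum_squares_bound[of "norm (f z)" "norm (g z)"] by (simp add: power2_sum)
      finally have "(norm (f z + g z))\<^sup>2 * exp (- (norm z)\<^sup>2)
          \<le> (2 * (norm (f z))\<^sup>2 + 2 * (norm (g z))\<^sup>2) * exp (- (norm z)\<^sup>2)"
        by (rule mult_right_mono) simp
      then show "norm ((norm (f z + g z))\<^sup>2 * exp (- (norm z)\<^sup>2))
          \<le> norm (2 * ((norm (f z))\<^sup>2 * exp (- (norm z)\<^sup>2)) + 2 * ((norm (g z))\<^sup>2 * exp (- (norm z)\<^sup>2)))"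
        by (simp add: algebra_simps)
    qed
  qed measurable
qed

lemma fock_diff:
  assumes "f \<in> fock" "g \<in> fock"
  shows "(\<lambda>z. f z - g z) \<in> fock"
  using fock_add[OF assms(1) fock_scale[OF assms(2), of "-1"]] by simp

lemma fock_inner_integrable:
  assumes "f \<in> fock" "g \<in> fock"
  shows "integrable lborel (\<lambda>z. f z * cnj (g z) * of_real (exp (- (norm z)\<^sup>2)))"
proof -
  have [measurable]: "f \<in> borel_measurable borel" "g \<in> borel_measurable borel"
    using assms by (auto intro: fock_measurable)
  have "integrable lborel (\<lambda>z. (norm (f z))\<^sup>2 * exp (- (norm z)\<^sup>2) + (norm (g z))\<^sup>2 * exp (- (norm z)\<^sup>2))"
    using assms by (auto simp: fock_iff)
  then show ?thesis
  proof (rule Bochner_Integration.integrable_bound)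
    show "AE z in lborel. norm (f z * cnj (g z) * of_real (exp (- (norm z)\<^sup>2)))
      \<le> norm ((norm (f z))\<^sup>2 * exp (- (norm z)\<^sup>2) + (norm (g z))\<^sup>2 * exp (- (norm z)\<^sup>2))"
    proof (rule AE_I2)
      fix z
      have "norm (f z) * norm (g z) \<le> (norm (f z))\<^sup>2 + (norm (g z))\<^sup>2"
        using sum_squares_bound[of "norm (f z)" "norm (g z)"]
          mult_nonneg_nonneg[OF norm_ge_zero norm_ge_zero, of "f z" "g z"]
        by linarith
      then have "norm (f z) * norm (g z) * exp (- (norm z)\<^sup>2)
          \<le> ((norm (f z))\<^sup>2 + (norm (g z))\<^sup>2) * exp (- (norm z)\<^sup>2)"
        by (rule mult_right_mono) simp
      then show "norm (f z * cnj (g z) * of_real (exp (- (norm z)\<^sup>2)))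
          \<le> norm ((norm (f z))\<^sup>2 * exp (- (norm z)\<^sup>2) + (norm (g z))\<^sup>2 * exp (- (norm z)\<^sup>2))"
        by (simp add: norm_mult algebra_simps)
    qed
  qed measurable
qed

lemma fock_norm_eq:
  "fock_norm f = sqrt ((\<integral>z. (norm (f z))\<^sup>2 * exp (- (norm z)\<^sup>2) \<partial>lborel) / pi)"
proof -
  have "(\<integral>z. f z * cnj (f z) * of_real (exp (- (norm z)\<^sup>2)) \<partial>lborel)
      = of_real (\<integral>z. (norm (f z))\<^sup>2 * exp (- (norm z)\<^sup>2) \<partial>lborel)"
    by (subst integral_complex_of_real[symmetric])
       (simp only: of_real_mult complex_norm_square)
  then show ?thesis
    by (simp add: fock_norm_def fock_inner_def)
qed

lemma fock_norm_nonneg: "0 \<le> fock_norm f"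
  by (auto simp: fock_norm_eq intro!: divide_nonneg_pos integral_nonneg_AE)

lemma fock_norm_square:
  "(fock_norm f)\<^sup>2 = (\<integral>z. (norm (f z))\<^sup>2 * exp (- (norm z)\<^sup>2) \<partial>lborel) / pi"
  unfolding fock_norm_eq by (subst real_sqrt_pow2) (auto intro!: divide_nonneg_pos integral_nonneg_AE)

lemma fock_inner_cnj: "fock_inner g f = cnj (fock_inner f g)"
proof -
  have "(\<integral>z. g z * cnj (f z) * of_real (exp (- (norm z)\<^sup>2)) \<partial>lborel)
      = (\<integral>z. cnj (f z * cnj (g z) * of_real (exp (- (norm z)\<^sup>2))) \<partial>lborel)"
    by (simp add: mult.commute)
  also have "\<dots> = cnj (\<integral>z. f z * cnj (g z) * of_real (exp (- (norm z)\<^sup>2)) \<partial>lborel)"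
    by (rule Bochner_Integration.integral_cnj)
  finally show ?thesis
    by (simp add: fock_inner_def)
qed

lemma fock_inner_scale_left: "fock_inner (\<lambda>z. c * f z) g = c * fock_inner f g"
proof -
  have "(\<integral>z. c * f z * cnj (g z) * of_real (exp (- (norm z)\<^sup>2)) \<partial>lborel)
      = (\<integral>z. c * (f z * cnj (g z) * of_real (exp (- (norm z)\<^sup>2))) \<partial>lborel)"
    by (simp add: mult.assoc)
  then show ?thesis
    by (simp add: fock_inner_def)
qed

lemma fock_const: "(\<lambda>z. c) \<in> fock"
  using has_bochner_integral_complex_gaussian
  by (auto simp: fock_iff has_bochner_integral_iff)

section \<open>Weyl translations\<close>

text \<open>Up to the factor \<open>exp (- \<bar>w\<bar>\<^sup>2 / 2)\<close> this is the unitary Weyl translation operator.\<close>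

definition weyl :: "complex \<Rightarrow> (complex \<Rightarrow> complex) \<Rightarrow> complex \<Rightarrow> complex" where
  "weyl w f z = f (z + w) * exp (- cnj w * z)"

text \<open>Writing the shifted Gaussian as a complex exponential in \<open>z\<close> and
  \<open>cnj z\<close> lets it be merged with exponential weights by adding exponents.\<close>

lemma gaussian_translate:
  "complex_of_real (exp (- (norm (z + w))\<^sup>2))
   = exp (- z * cnj z - w * cnj w - z * cnj w - w * cnj z)"
proof -
  have "complex_of_real ((norm (z + w))\<^sup>2) = (z + w) * cnj (z + w)"
    by (simp only: complex_norm_square)
  then have "complex_of_real (exp (- (norm (z + w))\<^sup>2)) = exp (- ((z + w) * cnj (z + w)))"
    by (simp add: exp_of_real[symmetric] del: of_real_power)
  also have "- ((z + w) * cnj (z + w)) = - z * cnj z - w * cnj w - z * cnj w - w * cnj z"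
    by (simp add: algebra_simps)
  finally show ?thesis .
qed

lemma gaussian_eq: "complex_of_real (exp (- (norm z)\<^sup>2)) = exp (- z * cnj z)"
  using gaussian_translate[of z 0] by simp

text \<open>The cross terms \<open>z * cnj w\<close> and \<open>w * cnj z\<close> of the shifted
  Gaussian are exactly the two exponential weights contributed by \<open>weyl\<close>.\<close>

lemma weyl_mult:
  "weyl w f z * cnj (weyl w g z) * of_real (exp (- (norm z)\<^sup>2))
   = exp (w * cnj w) * (f (z + w) * cnj (g (z + w)) * of_real (exp (- (norm (z + w))\<^sup>2)))"
  unfolding gaussian_translate gaussian_eq weyl_def
  by (simp add: exp_diff exp_minus exp_add exp_cnj field_simps)

lemma weyl_norm_square:
  "(norm (weyl w f z))\<^sup>2 * exp (- (norm z)\<^sup>2)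
   = exp ((norm w)\<^sup>2) * ((norm (f (z + w)))\<^sup>2 * exp (- (norm (z + w))\<^sup>2))"
proof -
  have "complex_of_real ((norm (weyl w f z))\<^sup>2 * exp (- (norm z)\<^sup>2))
      = complex_of_real (exp ((norm w)\<^sup>2) * ((norm (f (z + w)))\<^sup>2 * exp (- (norm (z + w))\<^sup>2)))"
    using weyl_mult[of w f z f]
    by (simp add: complex_norm_square exp_of_real[symmetric] del: of_real_power)
  then show ?thesis
    using of_real_eq_iff by blast
qed

lemma
  assumes "f \<in> fock"
  shows weyl_fock: "weyl w f \<in> fock"
    and weyl_integral: "(\<integral>z. (norm (weyl w f z))\<^sup>2 * exp (- (norm z)\<^sup>2) \<partial>lborel)
      = exp ((norm w)\<^sup>2) * (\<integral>z. (norm (f z))\<^sup>2 * exp (- (norm z)\<^sup>2) \<partial>lborel)"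
proof -
  have [measurable]: "f \<in> borel_measurable borel"
    using assms by (auto intro: fock_measurable)
  let ?F = "\<lambda>z. (norm (f z))\<^sup>2 * exp (- (norm z)\<^sup>2)"
  have I: "integrable lborel (\<lambda>z. ?F (z + w))"
    using assms by (subst integrable_translation) (auto simp: fock_iff)
  have "weyl w f holomorphic_on UNIV"
    unfolding weyl_def using fock_entire[OF assms]
    by (auto intro!: holomorphic_intros entire_compose[where f = f])
  then show "weyl w f \<in> fock"
    using I by (simp add: fock_iff weyl_norm_square)
  show "(\<integral>z. (norm (weyl w f z))\<^sup>2 * exp (- (norm z)\<^sup>2) \<partial>lborel)
      = exp ((norm w)\<^sup>2) * (\<integral>z. (norm (f z))\<^sup>2 * exp (- (norm z)\<^sup>2) \<partial>lborel)"
    using integral_translation[of ?F w] by (simp add: weyl_norm_square)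
qed

section \<open>Reproducing kernels and point evaluation\<close>

definition fock_kernel :: "complex \<Rightarrow> complex \<Rightarrow> complex" where
  "fock_kernel w = (\<lambda>z. exp (cnj w * z))"

lemma fock_kernel_fock: "fock_kernel w \<in> fock"
proof -
  have "weyl (- w) (\<lambda>_. 1) = fock_kernel w"
    by (auto simp: weyl_def fock_kernel_def)
  then show ?thesis
    using weyl_fock[OF fock_const[of 1], of "- w"] by simp
qed

text \<open>The Gaussian is radial, so averaging over rotations replaces \<open>h\<close> by its
  mean value \<open>h 0\<close>; the total Gaussian mass is \<open>pi\<close>.\<close>

lemma fock_gaussian_mean:
  assumes "h \<in> fock"
  shows "(\<integral>z. h z * of_real (exp (- (norm z)\<^sup>2)) \<partial>lborel) = of_real pi * h 0"
proof -
  let ?F = "\<lambda>z. h z * complex_of_real (exp (- (norm z)\<^sup>2))"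
  have I: "integrable lborel ?F"
    using fock_inner_integrable[OF assms fock_const[of 1]] by simp
  have "circle_mean ?F z = h 0 * of_real (exp (- (norm z)\<^sup>2))" for z
    using powser_circle_mean_value[OF entire_powser[OF fock_entire[OF assms]], of z]
    by (simp add: circle_mean_def norm_mult)
  then have "(\<integral>z. ?F z \<partial>lborel) = (\<integral>z. h 0 * of_real (exp (- (norm (z::complex))\<^sup>2)) \<partial>lborel)"
    using integral_circle_mean[OF I] by simp
  also have "\<dots> = h 0 * of_real pi"
    using has_bochner_integral_integral_eq[OF has_bochner_integral_complex_gaussian]
    by (simp del: of_real_exp)
  finally show ?thesis by (simp add: mult.commute)
qed

text \<open>Translation by \<open>w\<close> turns the pairing with the kernel into the Gaussian
  integral of \<open>weyl w f\<close>, whose value at the origin is \<open>f w\<close>.\<close>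

lemma fock_reproducing:
  assumes "f \<in> fock"
  shows "fock_inner f (fock_kernel w) = f w"
proof -
  have [measurable]: "f \<in> borel_measurable borel"
    using assms by (auto intro: fock_measurable)
  let ?F = "\<lambda>z. f z * cnj (fock_kernel w z) * of_real (exp (- (norm z)\<^sup>2))"
  have "?F (z + w) = weyl w f z * of_real (exp (- (norm z)\<^sup>2))" for z
    unfolding gaussian_translate gaussian_eq weyl_def fock_kernel_def
    by (simp add: exp_diff exp_minus exp_add exp_cnj field_simps)
  then have "(\<integral>z. ?F z \<partial>lborel) = (\<integral>z. weyl w f z * of_real (exp (- (norm z)\<^sup>2)) \<partial>lborel)"
    using integral_translation[of ?F w] by (simp add: fock_kernel_def)
  also have "\<dots> = of_real pi * f w"
    by (subst fock_gaussian_mean[OF weyl_fock[OF assms]]) (simp add: weyl_def)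
  finally show ?thesis
    by (simp add: fock_inner_def)
qed

text \<open>This is Pythagoras' theorem for the projection onto constants: the Gaussian integral of
  the square of \<open>norm (h z - h 0)\<close> is non-negative, and its cross term is known from
  the Gaussian mean.\<close>

lemma fock_norm_zero_bound:
  assumes "h \<in> fock"
  shows "pi * (norm (h 0))\<^sup>2 \<le> (\<integral>z. (norm (h z))\<^sup>2 * exp (- (norm z)\<^sup>2) \<partial>lborel)"
proof -
  let ?e = "\<lambda>z::complex. exp (- (norm z)\<^sup>2)"
  have I0: "integrable lborel (\<lambda>z. (norm (h z))\<^sup>2 * ?e z)"
    using assms by (simp add: fock_iff)
  have I1: "integrable lborel (\<lambda>z. h z * of_real (?e z))"
    using fock_inner_integrable[OF assms fock_const[of 1]] by simp
  have I2: "integrable lborel ?e" "integral\<^sup>L lborel ?e = pi"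
    using has_bochner_integral_complex_gaussian by (auto simp: has_bochner_integral_iff)
  have sq: "(norm (h z - h 0))\<^sup>2 = (norm (h z))\<^sup>2 - 2 * Re (cnj (h 0) * h z) + (norm (h 0))\<^sup>2" for z
    unfolding cmod_power2 by (simp add: power2_eq_square algebra_simps)
  define R where "R = (\<lambda>z. Re (cnj (h 0) * (h z * of_real (?e z))))"
  have R: "integrable lborel R"
    "integral\<^sup>L lborel R = Re (cnj (h 0) * (\<integral>z. h z * of_real (?e z) \<partial>lborel))"
    unfolding R_def using Bochner_Integration.integrable_mult_right[OF I1, of "cnj (h 0)"] 
      Bochner_Integration.integral_mult_right[OF I1, of "cnj (h 0)"]
    by (simp_all only: integrable_Re Bochner_Integration.integral_Re)
  have "(norm (h z - h 0))\<^sup>2 * ?e z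
      = (norm (h z))\<^sup>2 * ?e z - 2 * R z + (norm (h 0))\<^sup>2 * ?e z" for z
    unfolding sq R_def by (simp add: algebra_simps)
  then have "(\<integral>z. (norm (h z - h 0))\<^sup>2 * ?e z \<partial>lborel)
      = (\<integral>z. (norm (h z))\<^sup>2 * ?e z \<partial>lborel) - 2 * integral\<^sup>L lborel R + (norm (h 0))\<^sup>2 * pi"
    using I0 R(1) I2 by simp
  also have "\<dots> = (\<integral>z. (norm (h z))\<^sup>2 * ?e z \<partial>lborel) - pi * (norm (h 0))\<^sup>2"
    unfolding R(2) fock_gaussian_mean[OF assms] cmod_power2[of "h 0"]
    by (simp add: power2_eq_square algebra_simps)
  finally have "(\<integral>z. (norm (h z - h 0))\<^sup>2 * ?e z \<partial>lborel)
      = (\<integral>z. (norm (h z))\<^sup>2 * ?e z \<partial>lborel) - pi * (norm (h 0))\<^sup>2" .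
  moreover have "0 \<le> (\<integral>z. (norm (h z - h 0))\<^sup>2 * ?e z \<partial>lborel)"
    by (intro integral_nonneg_AE) simp
  ultimately show ?thesis by linarith
qed

text \<open>The bound at the origin is applied to \<open>weyl w f\<close>, which moves
  \<open>w\<close> to the origin at the cost of the factor \<open>exp ((norm w)\<^sup>2)\<close> in
  the squared norm.\<close>

lemma fock_pointwise_bound:
  assumes "f \<in> fock"
  shows "norm (f w) \<le> fock_norm f * exp ((norm w)\<^sup>2 / 2)"
proof -
  have "(norm (f w))\<^sup>2 \<le> (fock_norm f)\<^sup>2 * exp ((norm w)\<^sup>2)"
    using fock_norm_zero_bound[OF weyl_fock[OF assms, of w]]
    unfolding weyl_integral[OF assms] fock_norm_square
    by (simp add: weyl_def field_simps)
  also have "\<dots> = (fock_norm f * exp ((norm w)\<^sup>2 / 2))\<^sup>2"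
    by (simp add: power_mult_distrib flip: exp_double)
  finally show ?thesis
    by (rule power2_le_imp_le) (simp add: fock_norm_nonneg)
qed

section \<open>Taylor polynomials and dilations\<close>

text \<open>With \<open>norm z\<close> at most the sum of the absolute values of the coordinates,
  \<open>exp (2 * c * norm z)\<close> is dominated by the squared kernels at the four corners of the
  square with coordinates \<open>c\<close> and \<open>- c\<close>. Those are integrable against the
  Gaussian.\<close>

lemma fock_exponential_typeI:
  assumes f: "f holomorphic_on UNIV" and bd: "\<And>z. norm (f z) \<le> M * exp (c * norm z)" and c: "0 \<le> c"
  shows "f \<in> fock"
  unfolding fock_iff
proof
  let ?k = "\<lambda>w z. (norm (fock_kernel w z))\<^sup>2"
  let ?S = "\<lambda>z. ?k (Complex c c) z + ?k (Complex c (-c)) z + ?k (Complex (-c) c) z + ?k (Complex (-c) (-c)) z"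
  have [measurable]: "f \<in> borel_measurable borel"
    using f by (rule entire_measurable)
  have "integrable lborel (\<lambda>z. M\<^sup>2 * (?k (Complex c c) z * exp (- (norm z)\<^sup>2) + ?k (Complex c (-c)) z * exp (- (norm z)\<^sup>2)
      + ?k (Complex (-c) c) z * exp (- (norm z)\<^sup>2) + ?k (Complex (-c) (-c)) z * exp (- (norm z)\<^sup>2)))"
    using fock_kernel_fock
    by (intro Bochner_Integration.integrable_mult_right Bochner_Integration.integrable_add) (auto simp: fock_iff)
  then have "integrable lborel (\<lambda>z. M\<^sup>2 * ?S z * exp (- (norm z)\<^sup>2))"
    by (simp add: algebra_simps)
  then show "integrable lborel (\<lambda>z. (norm (f z))\<^sup>2 * exp (- (norm z)\<^sup>2))"
  proof (rule Bochner_Integration.integrable_bound)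
    show "AE z in lborel. norm ((norm (f z))\<^sup>2 * exp (- (norm z)\<^sup>2)) \<le> norm (M\<^sup>2 * ?S z * exp (- (norm z)\<^sup>2))"
    proof (rule AE_I2)
      fix z
      have k: "?k (Complex a b) z = exp (2 * a * Re z) * exp (2 * b * Im z)" for a b
        by (simp add: fock_kernel_def norm_exp_eq_Re exp_add exp_double power_mult_distrib mult.assoc)
      have "norm z \<le> \<bar>Re z\<bar> + \<bar>Im z\<bar>" by (rule cmod_le)
      then have "exp (2 * c * norm z) \<le> exp (2 * c * \<bar>Re z\<bar>) * exp (2 * c * \<bar>Im z\<bar>)"
        using c mult_left_mono[of "norm z" "\<bar>Re z\<bar> + \<bar>Im z\<bar>" "2 * c"]
        by (simp add: exp_add[symmetric] distrib_left)
      also have "\<dots> \<le> (exp (2 * c * Re z) + exp (2 * (- c) * Re z)) * (exp (2 * c * Im z) + exp (2 * (- c) * Im z))"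
        by (intro mult_mono) (auto simp: abs_if)
      also have "\<dots> = ?S z"
        unfolding k by (simp only: algebra_simps)
      finally have S: "exp (2 * c * norm z) \<le> ?S z" .
      have "(norm (f z))\<^sup>2 \<le> (M * exp (c * norm z))\<^sup>2"
        by (intro power_mono bd) auto
      also have "\<dots> = M\<^sup>2 * exp (2 * c * norm z)"
        by (simp add: power_mult_distrib exp_double mult.assoc)
      also have "\<dots> \<le> M\<^sup>2 * ?S z"
        using S by (intro mult_left_mono) auto
      finally have "(norm (f z))\<^sup>2 * exp (- (norm z)\<^sup>2) \<le> M\<^sup>2 * ?S z * exp (- (norm z)\<^sup>2)"
        by (intro mult_right_mono) auto
      then show "norm ((norm (f z))\<^sup>2 * exp (- (norm z)\<^sup>2)) \<le> norm (M\<^sup>2 * ?S z * exp (- (norm z)\<^sup>2))"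
        by (simp only: real_norm_def abs_of_nonneg[OF mult_nonneg_nonneg[OF zero_le_power2 exp_ge_zero]])
    qed
  qed measurable
qed fact

text \<open>A single term of the exponential series is at most its sum, so \<open>norm z ^ n\<close>
  is at most \<open>fact n * exp (norm z)\<close>. Polynomials thus satisfy the exponential growth
  criterion for \<open>fock\<close>.\<close>

lemma polynomial_exp_bound:
  fixes a :: "nat \<Rightarrow> complex"
  shows "norm (\<Sum>n<N. a n * z ^ n) \<le> (\<Sum>n<N. norm (a n) * fact n) * exp (norm z)"
proof -
  have "norm z ^ n \<le> fact n * exp (norm z)" for n
  proof -
    have "norm z ^ n / fact n \<le> (\<Sum>k. norm z ^ k / fact k)"
      using sum_le_suminf[OF summable_exp[of "norm z"], of "{n}"] by (simp add: divide_inverse mult.commute)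
    then show ?thesis
      by (simp add: exp_def field_simps)
  qed
  then have "norm (a n * z ^ n) \<le> norm (a n) * fact n * exp (norm z)" for n
    by (simp add: norm_mult norm_power mult_left_mono mult.assoc)
  then show ?thesis
    unfolding sum_distrib_right by (rule sum_norm_le)
qed

lemma circle_parseval_norm:
  fixes a :: "nat \<Rightarrow> complex"
  assumes f: "\<And>z. (\<lambda>n. a n * z ^ n) sums f z"
  shows "(\<lambda>n. (norm (a n * z ^ n))\<^sup>2) sums circle_mean (\<lambda>z. (norm (f z))\<^sup>2) z"
proof -
  have "circle_mean (\<lambda>z. f (1 * z) * cnj (f z)) z = of_real (circle_mean (\<lambda>z. (norm (f z))\<^sup>2) z)"
    unfolding circle_mean_def
    by (subst integral_complex_of_real[symmetric]) (simp only: complex_norm_square mult_1)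
  moreover have "1 ^ n * a n * cnj (a n) * (z * cnj z) ^ n = of_real ((norm (a n * z ^ n))\<^sup>2)" for n
    unfolding complex_norm_square by (simp add: power_mult_distrib mult_ac)
  ultimately show ?thesis
    using powser_circle_parseval[OF f f, of 1 z] by (simp only: sums_of_real_iff)
qed

text \<open>On each circle the mean square of the Taylor remainder is a tail of the Parseval series,
  hence tends to 0 and never exceeds the full sum. Dominated convergence then carries this over to
  the plane and shows that polynomials are dense.\<close>

lemma fock_taylor_converges:
  assumes f: "f \<in> fock" and a: "\<And>z. (\<lambda>n. a n * z ^ n) sums f z"
  shows "(\<lambda>N. fock_norm (\<lambda>z. f z - (\<Sum>n<N. a n * z ^ n))) \<longlonglongrightarrow> 0"
proof -
  let ?e = "\<lambda>z::complex. exp (- (norm z)\<^sup>2)"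
  define u where "u = (\<lambda>z n. (norm (a n * z ^ n))\<^sup>2)"
  define r where "r = (\<lambda>N z. f z - (\<Sum>n<N. a n * z ^ n))"
  \<comment> \<open>The remainder is presented as a power series whose first \<open>N\<close>
    coefficients vanish, so that Parseval's identity applies to it.\<close>
  have r_powser: "(\<lambda>n. (if n < N then 0 else a n) * z ^ n) sums r N z" for N z
  proof -
    have "(\<lambda>n. if n \<in> {..<N} then a n * z ^ n else 0) sums (\<Sum>n<N. a n * z ^ n)"
      by (rule sums_If_finite_set) simp
    from sums_diff[OF a this] show ?thesis
      unfolding r_def by (rule sums_cong[THEN iffD1, rotated]) auto
  qed
  have poly: "(\<lambda>z. \<Sum>n<N. a n * z ^ n) \<in> fock" for N
    by (rule fock_exponential_typeI[where c = 1]) (use polynomial_exp_bound in \<open>auto intro!: holomorphic_intros\<close>)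
  have r: "r N \<in> fock" for N
    unfolding r_def using f poly by (rule fock_diff)
  define P where "P = (\<lambda>N. circle_mean (\<lambda>z. (norm (r N z))\<^sup>2))"
  have P: "(\<lambda>n. if n < N then 0 else u z n) sums P N z" for N z
    unfolding P_def
    by (rule sums_cong[THEN iffD1, OF _ circle_parseval_norm[OF r_powser]]) (auto simp: u_def)
  have P_tail: "P N z = P 0 z - (\<Sum>n<N. u z n)" for N z
  proof -
    have "(\<lambda>n. if n \<in> {..<N} then u z n else 0) sums (\<Sum>n<N. u z n)"
      by (rule sums_If_finite_set) simp
    from sums_diff[OF P[of 0 z] this] have "(\<lambda>n. if n < N then 0 else u z n) sums (P 0 z - (\<Sum>n<N. u z n))"
      by (rule sums_cong[THEN iffD1, rotated]) auto
    then show ?thesis using P sums_unique2 by blast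
  qed
  have P_lim: "(\<lambda>N. P N z) \<longlonglongrightarrow> 0" for z
  proof -
    have "(\<lambda>N. \<Sum>n<N. u z n) \<longlonglongrightarrow> P 0 z"
      using P[of 0 z] by (simp add: sums_def)
    from tendsto_diff[OF tendsto_const this, of "P 0 z"] show ?thesis
      by (subst P_tail) simp
  qed
  have P_nonneg: "0 \<le> P N z" for N z
    using P by (rule sums_le[OF _ sums_zero, rotated]) (simp add: u_def)
  have P_le: "P N z \<le> P 0 z" for N z
    unfolding P_tail[of N] by (simp add: sum_nonneg u_def)
  have mean: "circle_mean (\<lambda>z. (norm (r N z))\<^sup>2 * ?e z) = (\<lambda>z. P N z * ?e z)" for N
    by (simp add: circle_mean_def P_def norm_mult fun_eq_iff)
  have I: "integrable lborel (\<lambda>z. (norm (r N z))\<^sup>2 * ?e z)" for N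
    using r by (simp add: fock_iff)
  have IP: "integrable lborel (\<lambda>z. P N z * ?e z)" for N
    using integrable_circle_mean[OF I[of N]] by (simp add: mean)
  have "(\<lambda>N. \<integral>z. P N z * ?e z \<partial>lborel) \<longlonglongrightarrow> (\<integral>z. 0 \<partial>(lborel :: complex measure))"
  \<comment> \<open>Since \<open>r 0\<close> is \<open>f\<close>, the majorant is the circle mean of
    the integrand defining the norm of \<open>f\<close>.\<close>
  proof (rule integral_dominated_convergence[where w = "\<lambda>z. P 0 z * ?e z"])
    show "AE z in lborel. (\<lambda>N. P N z * ?e z) \<longlonglongrightarrow> 0"
      using tendsto_mult_right[OF P_lim] by (intro AE_I2) simp
    show "AE z in lborel. norm (P N z * ?e z) \<le> P 0 z * ?e z" for N
      using P_nonneg P_le by (intro AE_I2) (simp add: abs_mult mult_right_mono)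
  qed (use IP in auto)
  moreover have "(\<integral>z. P N z * ?e z \<partial>lborel) = (\<integral>z. (norm (r N z))\<^sup>2 * ?e z \<partial>lborel)" for N
    using integral_circle_mean[OF I[of N]] by (simp add: mean)
  ultimately have "(\<lambda>N. \<integral>z. (norm (r N z))\<^sup>2 * ?e z \<partial>lborel) \<longlonglongrightarrow> 0"
    by simp
  then have "(\<lambda>N. sqrt ((\<integral>z. (norm (r N z))\<^sup>2 * ?e z \<partial>lborel) / pi)) \<longlonglongrightarrow> sqrt (0 / pi)"
    by (intro tendsto_intros) auto
  then show ?thesis
    by (simp add: fock_norm_eq r_def)
qed

text \<open>For real \<open>A\<close> both integrands have the same Parseval series on every circle,
  hence the same circle means. Integrability is required of the two products only, so that dilations
  with \<open>A\<close> of any size are covered.\<close>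

lemma dilation_symmetric:
  assumes f: "f holomorphic_on UNIV" and g: "g holomorphic_on UNIV" and A: "A \<in> \<real>"
    and I1: "integrable lborel (\<lambda>z. f (A * z) * cnj (g z) * of_real (exp (- (norm z)\<^sup>2)))"
    and I2: "integrable lborel (\<lambda>z. f z * cnj (g (A * z)) * of_real (exp (- (norm z)\<^sup>2)))"
  shows "(\<integral>z. f (A * z) * cnj (g z) * of_real (exp (- (norm z)\<^sup>2)) \<partial>lborel)
       = (\<integral>z. f z * cnj (g (A * z)) * of_real (exp (- (norm z)\<^sup>2)) \<partial>lborel)"
proof -
  define a b where "a = (\<lambda>n. (deriv ^^ n) f 0 / fact n)" and "b = (\<lambda>n. (deriv ^^ n) g 0 / fact n)"
  have a: "(\<lambda>n. a n * z ^ n) sums f z" and b: "(\<lambda>n. b n * z ^ n) sums g z" for z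
    unfolding a_def b_def by (rule entire_powser[OF f], rule entire_powser[OF g])
  have "circle_mean (\<lambda>z. f (A * z) * cnj (g z)) z = circle_mean (\<lambda>z. f z * cnj (g (A * z))) z" for z
  proof -
    have 1: "(\<lambda>n. A ^ n * a n * cnj (b n) * (z * cnj z) ^ n) sums circle_mean (\<lambda>z. f (A * z) * cnj (g z)) z"
      by (rule powser_circle_parseval[OF a b])
    \<comment> \<open>Parseval's identity with \<open>f\<close> and \<open>g\<close> exchanged, then
      conjugated, gives the other side; conjugation fixes \<open>A ^ n\<close> because
      \<open>A\<close> is real.\<close>
    have "(\<lambda>n. cnj (A ^ n * b n * cnj (a n) * (z * cnj z) ^ n)) sums
        cnj (circle_mean (\<lambda>z. g (A * z) * cnj (f z)) z)"
      by (subst sums_cnj) (rule powser_circle_parseval[OF b a])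
    also have "cnj (circle_mean (\<lambda>z. g (A * z) * cnj (f z)) z) = circle_mean (\<lambda>z. f z * cnj (g (A * z))) z"
      unfolding circle_mean_def by (subst Bochner_Integration.integral_cnj[symmetric]) (simp add: mult.commute)
    finally have 2: "(\<lambda>n. A ^ n * a n * cnj (b n) * (z * cnj z) ^ n) sums circle_mean (\<lambda>z. f z * cnj (g (A * z))) z"
      using A by (simp add: Reals_cnj_iff mult_ac)
    show ?thesis
      using 1 2 by (rule sums_unique2)
  qed
  moreover have "circle_mean (\<lambda>z. F z * complex_of_real (exp (- (norm z)\<^sup>2))) z
      = circle_mean F z * of_real (exp (- (norm z)\<^sup>2))" for F z
    by (simp add: circle_mean_def norm_mult)
  ultimately have "circle_mean (\<lambda>z. f (A * z) * cnj (g z) * of_real (exp (- (norm z)\<^sup>2)))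
      = circle_mean (\<lambda>z. f z * cnj (g (A * z)) * of_real (exp (- (norm z)\<^sup>2)))"
    by (intro ext) (simp only:)
  then show ?thesis
    using integral_circle_mean[OF I1] integral_circle_mean[OF I2] by simp
qed

text \<open>Moving the origin to the fixed point of the affine map turns both integrands into the
  dilation integrands of the Weyl translates of \<open>f\<close> and \<open>g\<close>, with one
  common constant in front.\<close>

lemma wco_symmetric_fixed_point:
  fixes A C :: real and B :: complex
  assumes f: "f holomorphic_on UNIV" and g: "g holomorphic_on UNIV" and A: "A \<noteq> 1" and C: "C \<noteq> 0"
    and I1: "integrable lborel (\<lambda>z. of_real C * exp (cnj B * z) * f (of_real A * z + B) * cnj (g z) * of_real (exp (- (norm z)\<^sup>2)))"
    and I2: "integrable lborel (\<lambda>z. f z * cnj (of_real C * exp (cnj B * z) * g (of_real A * z + B)) * of_real (exp (- (norm z)\<^sup>2)))"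
  shows "(\<integral>z. of_real C * exp (cnj B * z) * f (of_real A * z + B) * cnj (g z) * of_real (exp (- (norm z)\<^sup>2)) \<partial>lborel)
       = (\<integral>z. f z * cnj (of_real C * exp (cnj B * z) * g (of_real A * z + B)) * of_real (exp (- (norm z)\<^sup>2)) \<partial>lborel)"
    (is "integral\<^sup>L lborel ?F = integral\<^sup>L lborel ?G")
proof -
  \<comment> \<open>The fixed point: \<open>p = A * p + B\<close>.\<close>
  define p where "p = B / of_real (1 - A)"
  have B: "B = of_real (1 - A) * p"
    using A by (simp add: p_def)
  \<comment> \<open>The part of the exponent free of \<open>z\<close> after the shift. It is real,
    so the conjugation in \<open>G\<close> leaves it unchanged and the same \<open>c\<close> serves
    both sides.\<close>
  define c where "c = of_real C * exp (- of_real A * (p * cnj p))"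
  have c: "c \<noteq> 0" using C by (simp add: c_def)
  have fp: "of_real A * (z + p) + B = of_real A * z + p" for z
    by (simp add: B algebra_simps)
  define F G where "F = ?F" and "G = ?G"
  have F: "F (z + p) = c * (weyl p f (of_real A * z) * cnj (weyl p g z) * of_real (exp (- (norm z)\<^sup>2)))" for z
  proof -
    have "exp (cnj B * (z + p)) * exp (- z * cnj z - p * cnj p - z * cnj p - p * cnj z)
        = exp (- of_real A * (p * cnj p)) * exp (- cnj p * (of_real A * z)) * cnj (exp (- cnj p * z)) * exp (- z * cnj z)"
      unfolding exp_cnj mult_exp_exp by (rule arg_cong[where f = exp]) (simp add: B algebra_simps)
    then show ?thesis
      unfolding F_def fp gaussian_translate[of z p] gaussian_eq[of z] weyl_def c_def complex_cnj_mult by algebra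
  qed
  have G: "G (z + p) = c * (weyl p f z * cnj (weyl p g (of_real A * z)) * of_real (exp (- (norm z)\<^sup>2)))" for z
  proof -
    have "cnj (exp (cnj B * (z + p))) * exp (- z * cnj z - p * cnj p - z * cnj p - p * cnj z)
        = exp (- of_real A * (p * cnj p)) * exp (- cnj p * z) * cnj (exp (- cnj p * (of_real A * z))) * exp (- z * cnj z)"
      unfolding exp_cnj mult_exp_exp by (rule arg_cong[where f = exp]) (simp add: B algebra_simps)
    then show ?thesis
      unfolding G_def fp gaussian_translate[of z p] gaussian_eq[of z] weyl_def c_def complex_cnj_mult complex_cnj_complex_of_real
      by algebra
  qed
  have hol: "weyl p f holomorphic_on UNIV" "weyl p g holomorphic_on UNIV"
    unfolding weyl_def using f g
    by (auto intro!: holomorphic_intros entire_compose[where f = f] entire_compose[where f = g])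
  have "integrable lborel F" "integrable lborel G"
    using I1 I2 by (simp_all only: F_def G_def)
  then have "integrable lborel (\<lambda>z. F (z + p))" "integrable lborel (\<lambda>z. G (z + p))"
    by (simp_all add: integrable_translation)
  then have 1: "integrable lborel (\<lambda>z. c * (weyl p f (of_real A * z) * cnj (weyl p g z) * of_real (exp (- (norm z)\<^sup>2))))"
    and 2: "integrable lborel (\<lambda>z. c * (weyl p f z * cnj (weyl p g (of_real A * z)) * of_real (exp (- (norm z)\<^sup>2))))"
    by (simp_all only: F G)
  have cancel: "integrable lborel h" if "integrable lborel (\<lambda>z. c * h z)" for h :: "complex \<Rightarrow> complex"
    using Bochner_Integration.integrable_mult_right[OF that, of "inverse c"] c
    by (simp flip: mult.assoc)
  from dilation_symmetric[OF hol _ cancel[OF 1] cancel[OF 2]]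
  have "(\<integral>z. F (z + p) \<partial>lborel) = (\<integral>z. G (z + p) \<partial>lborel)"
    unfolding F G by (simp del: of_real_exp)
  then have "integral\<^sup>L lborel F = integral\<^sup>L lborel G"
    using \<open>integrable lborel F\<close> \<open>integrable lborel G\<close> by (simp add: integral_translation)
  then show ?thesis
    by (simp only: F_def G_def)
qed

section \<open>Shifting vertical lines of integration\<close>

text \<open>This connects Lebesgue integrals over a line with gauge integrals over segments, which a
  primitive can evaluate.\<close>

lemma integral_truncation_tendsto:
  fixes h :: "real \<Rightarrow> complex"
  assumes h: "continuous_on UNIV h" and I: "integrable lborel h"
  shows "(\<lambda>n. integral {- real n..real n} h) \<longlonglongrightarrow> (\<integral>y. h y \<partial>lborel)"
proof -
  have [measurable]: "h \<in> borel_measurable borel"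
    using h by (rule borel_measurable_continuous_onI)
  have "(\<lambda>n. \<integral>y. indicator {- real n..real n} y *\<^sub>R h y \<partial>lborel) \<longlonglongrightarrow> (\<integral>y. h y \<partial>lborel)"
  proof (rule integral_dominated_convergence[where w = "\<lambda>y. norm (h y)"])
    show "AE y in lborel. (\<lambda>n. indicator {- real n..real n} y *\<^sub>R h y) \<longlonglongrightarrow> h y"
    proof (rule AE_I2)
      fix y
      obtain N where N: "\<bar>y\<bar> \<le> real N" using real_arch_simple by blast
      have "\<forall>\<^sub>F n in sequentially. indicator {- real n..real n} y *\<^sub>R h y = h y"
        using eventually_ge_at_top[of N] by eventually_elim (use N in \<open>auto simp: indicator_def\<close>)
      then show "(\<lambda>n. indicator {- real n..real n} y *\<^sub>R h y) \<longlonglongrightarrow> h y"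
        by (rule tendsto_eventually)
    qed
  qed (use I in \<open>auto split: split_indicator\<close>)
  moreover have "(\<integral>y. indicator {- real n..real n} y *\<^sub>R h y \<partial>lborel) = integral {- real n..real n} h" for n
    using set_borel_integral_eq_integral(2)[OF borel_integrable_atLeastAtMost', of "- real n" "real n" h]
      continuous_on_subset[OF h, of "{- real n..real n}"]
    by (simp add: set_lebesgue_integral_def)
  ultimately show ?thesis by simp
qed

lemma continuous_on_vertical_line:
  assumes "H holomorphic_on UNIV"
  shows "continuous_on UNIV (\<lambda>y. H (Complex s y))"
proof -
  have "continuous_on UNIV (\<lambda>y. Complex s y)"
    unfolding Complex_eq by (intro continuous_intros)
  then show ?thesis
    using continuous_on_compose2[OF holomorphic_on_imp_continuous_on[OF assms]] by blast
qed

text \<open>Cauchy's theorem on growing rectangles, expressed through a primitive \<open>P\<close>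
  of \<open>G\<close>: the truncated vertical integrals differ by increments of \<open>P\<close>
  along the horizontal sides, and these tend to 0 with \<open>D\<close>.\<close>

lemma vertical_line_shift_decaying:
  fixes G :: "complex \<Rightarrow> complex"
  assumes G: "G holomorphic_on UNIV" and s: "0 \<le> s"
    and bd: "\<And>x y. \<bar>x\<bar> \<le> s \<Longrightarrow> norm (G (Complex x y)) \<le> D y"
    and D: "(\<lambda>n. D (real n)) \<longlonglongrightarrow> 0" "(\<lambda>n. D (- real n)) \<longlonglongrightarrow> 0"
    and I1: "integrable lborel (\<lambda>y. G (Complex s y))"
    and I2: "integrable lborel (\<lambda>y. G (Complex (- s) y))"
  shows "(\<integral>y. G (Complex s y) \<partial>lborel) = (\<integral>y. G (Complex (- s) y) \<partial>lborel)"
proof -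
  obtain P where P: "\<And>z. (P has_field_derivative G z) (at z)"
    using holomorphic_convex_primitive'[of UNIV G] G by auto
  \<comment> \<open>The division by \<open>\<i>\<close> comes from parametrising the vertical
    segment by its imaginary part.\<close>
  have FTC: "integral {- real n..real n} (\<lambda>y. G (Complex x y)) = (P (Complex x (real n)) - P (Complex x (- real n))) / \<i>"
    for x and n :: nat
  proof -
    have "((\<lambda>y. P (Complex x y) / \<i>) has_vector_derivative G (Complex x y)) (at y within {- real n..real n})" for y
    proof -
      have "((\<lambda>w. P (of_real x + \<i> * w) / \<i>) has_field_derivative G (of_real x + \<i> * of_real y)) (at (of_real y))"
        by (rule derivative_eq_intros DERIV_chain'[OF _ P] refl | simp add: mult.assoc)+
      then show ?thesis
        using has_vector_derivative_real_field unfolding Complex_eq by blast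
    qed
    then have "((\<lambda>y. G (Complex x y)) has_integral (P (Complex x (real n)) / \<i> - P (Complex x (- real n)) / \<i>)) {- real n..real n}"
      by (intro fundamental_theorem_of_calculus) auto
    then show ?thesis
      by (simp add: has_integral_iff algebra_simps)
  qed
  have horiz: "norm (P (Complex s y) - P (Complex (- s) y)) \<le> D y * (2 * s)" for y
  proof -
    have "norm (P (Complex s y) - P (Complex (- s) y)) \<le> D y * norm (Complex s y - Complex (- s) y)"
    proof (rule field_differentiable_bound[where f' = G and S = "closed_segment (Complex (- s) y) (Complex s y)"])
      fix z assume "z \<in> closed_segment (Complex (- s) y) (Complex s y)"
      then have "z = Complex (Re z) y" "\<bar>Re z\<bar> \<le> s"
        using s by (auto simp: closed_segment_def complex_eq_iff abs_le_iff algebra_simps)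
           (smt (verit) mult_left_le_one_le mult_nonneg_nonneg)+
      then show "norm (G z) \<le> D y"
        using bd[of "Re z" y] by simp
    qed (auto intro: P has_field_derivative_at_within)
    also have "Complex s y - Complex (- s) y = of_real (2 * s)"
      by (simp add: complex_eq_iff)
    also have "norm (complex_of_real (2 * s)) = 2 * s"
      using s by (simp only: norm_of_real)
    finally show ?thesis .
  qed
  have "(\<lambda>n. integral {- real n..real n} (\<lambda>y. G (Complex s y)) - integral {- real n..real n} (\<lambda>y. G (Complex (- s) y)))
      \<longlonglongrightarrow> 0"
  proof (rule Lim_null_comparison[OF always_eventually, rule_format])
    fix n
    \<comment> \<open>The four corner values of \<open>P\<close> are regrouped from vertical into
      horizontal pairs, to which \<open>horiz\<close> applies.\<close>
    have "norm (integral {- real n..real n} (\<lambda>y. G (Complex s y)) - integral {- real n..real n} (\<lambda>y. G (Complex (- s) y)))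
        = norm ((P (Complex s (real n)) - P (Complex (- s) (real n))) - (P (Complex s (- real n)) - P (Complex (- s) (- real n))))"
      unfolding FTC diff_divide_distrib[symmetric] norm_divide norm_ii div_by_1
      by (simp add: algebra_simps)
    also have "\<dots> \<le> D (real n) * (2 * s) + D (- real n) * (2 * s)"
      by (rule order_trans[OF norm_triangle_ineq4 add_mono[OF horiz horiz]])
    finally show "norm (integral {- real n..real n} (\<lambda>y. G (Complex s y)) - integral {- real n..real n} (\<lambda>y. G (Complex (- s) y)))
        \<le> D (real n) * (2 * s) + D (- real n) * (2 * s)" .
  next
    show "(\<lambda>n. D (real n) * (2 * s) + D (- real n) * (2 * s)) \<longlonglongrightarrow> 0"
      using tendsto_add[OF tendsto_mult_right[OF D(1)] tendsto_mult_right[OF D(2)], of "2 * s" "2 * s"] by (simp add: mult.commute)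
  qed
  moreover have "(\<lambda>n. integral {- real n..real n} (\<lambda>y. G (Complex s y)) - integral {- real n..real n} (\<lambda>y. G (Complex (- s) y)))
      \<longlonglongrightarrow> (\<integral>y. G (Complex s y) \<partial>lborel) - (\<integral>y. G (Complex (- s) y) \<partial>lborel)"
    using I1 I2 continuous_on_vertical_line[OF G] by (intro tendsto_diff integral_truncation_tendsto)
  ultimately show ?thesis
    using LIMSEQ_unique by fastforce
qed

lemma norm_exp_square: "norm (exp (of_real \<epsilon> * (Complex x y)\<^sup>2)) = exp (\<epsilon> * (x\<^sup>2 - y\<^sup>2))"
  by (simp add: norm_exp_eq_Re power2_eq_square)

text \<open>The factors \<open>exp (\<epsilon> \<zeta>\<^sup>2)\<close> with \<open>\<epsilon> \<rightarrow> 0\<close> make the horizontal sides of the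
  rectangle negligible although \<open>H\<close> is only bounded on the strip.\<close>

lemma vertical_line_shift_bounded:
  fixes H :: "complex \<Rightarrow> complex"
  assumes H: "H holomorphic_on UNIV" and s: "0 \<le> s"
    and bd: "\<And>x y. \<bar>x\<bar> \<le> s \<Longrightarrow> norm (H (Complex x y)) \<le> K"
    and I1: "integrable lborel (\<lambda>y. H (Complex s y))"
    and I2: "integrable lborel (\<lambda>y. H (Complex (- s) y))"
  shows "(\<integral>y. H (Complex s y) \<partial>lborel) = (\<integral>y. H (Complex (- s) y) \<partial>lborel)"
proof -
  \<comment> \<open>The sequence tends to 0 and stays at most 1; the latter gives the majorant with
    factor \<open>exp (x\<^sup>2)\<close>, independent of \<open>n\<close>.\<close>
  define \<epsilon> where "\<epsilon> = (\<lambda>n. 1 / real (Suc n))"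
  define G where "G = (\<lambda>n z. H z * exp (of_real (\<epsilon> n) * z\<^sup>2))"
  have \<epsilon>: "0 < \<epsilon> n" "\<epsilon> n \<le> 1" for n by (auto simp: \<epsilon>_def)
  have \<epsilon>0: "\<epsilon> \<longlonglongrightarrow> 0"
    unfolding \<epsilon>_def using LIMSEQ_inverse_real_of_nat by (simp add: inverse_eq_divide)
  have G: "G n holomorphic_on UNIV" for n
    unfolding G_def using H by (auto intro!: holomorphic_intros)
  have [measurable]: "(\<lambda>y. H (Complex x y)) \<in> borel_measurable borel"
    "(\<lambda>y. G n (Complex x y)) \<in> borel_measurable borel" for x n
    using continuous_on_vertical_line[OF H] continuous_on_vertical_line[OF G]
    by (auto intro!: borel_measurable_continuous_onI)
  have G_le: "norm (G n (Complex x y)) \<le> norm (H (Complex x y)) * exp (x\<^sup>2)" for n x y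
  proof -
    have "\<epsilon> n * (x\<^sup>2 - y\<^sup>2) \<le> \<epsilon> n * x\<^sup>2"
      using \<epsilon>[of n] by (intro mult_left_mono) auto
    also have "\<dots> \<le> x\<^sup>2"
      using \<epsilon>[of n] by (intro mult_left_le_one_le) auto
    finally show ?thesis
      unfolding G_def norm_mult norm_exp_square by (intro mult_left_mono) auto
  qed
  have IG: "integrable lborel (\<lambda>y. G n (Complex x y))" if "integrable lborel (\<lambda>y. H (Complex x y))" for n x
    by (rule Bochner_Integration.integrable_bound[of _ "\<lambda>y. norm (H (Complex x y)) * exp (x\<^sup>2)"])
       (use that G_le in \<open>auto intro!: AE_I2\<close>)
  have lim: "(\<lambda>n. \<integral>y. G n (Complex x y) \<partial>lborel) \<longlonglongrightarrow> (\<integral>y. H (Complex x y) \<partial>lborel)"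
    if "integrable lborel (\<lambda>y. H (Complex x y))" for x
  proof (rule integral_dominated_convergence[where w = "\<lambda>y. norm (H (Complex x y)) * exp (x\<^sup>2)"])
    show "AE y in lborel. (\<lambda>n. G n (Complex x y)) \<longlonglongrightarrow> H (Complex x y)"
    proof (rule AE_I2)
      fix y
      have "(\<lambda>n. G n (Complex x y)) \<longlonglongrightarrow> H (Complex x y) * exp (of_real 0 * (Complex x y)\<^sup>2)"
        unfolding G_def by (intro tendsto_intros \<epsilon>0)
      then show "(\<lambda>n. G n (Complex x y)) \<longlonglongrightarrow> H (Complex x y)" by simp
    qed
  qed (use that G_le in auto)
  have eq: "(\<integral>y. G n (Complex s y) \<partial>lborel) = (\<integral>y. G n (Complex (- s) y) \<partial>lborel)" for n
  \<comment> \<open>On the strip the real part of the square of \<open>Complex x y\<close> is at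
    most \<open>s\<^sup>2 - y\<^sup>2\<close>, so for fixed \<open>n\<close> the regularised
    function decays like a Gaussian in \<open>y\<close>.\<close>
  proof (rule vertical_line_shift_decaying[OF G s _ _ _ IG[OF I1] IG[OF I2], where D = "\<lambda>y. K * exp (\<epsilon> n * (s\<^sup>2 - y\<^sup>2))"])
    fix x y :: real assume x: "\<bar>x\<bar> \<le> s"
    then have "x\<^sup>2 \<le> s\<^sup>2" using s by (simp add: abs_le_square_iff[symmetric])
    then have "exp (\<epsilon> n * (x\<^sup>2 - y\<^sup>2)) \<le> exp (\<epsilon> n * (s\<^sup>2 - y\<^sup>2))"
      using \<epsilon>[of n] by (simp add: mult_left_mono)
    then show "norm (G n (Complex x y)) \<le> K * exp (\<epsilon> n * (s\<^sup>2 - y\<^sup>2))"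
      unfolding G_def norm_mult norm_exp_square
      using bd[OF x, of y] order_trans[OF norm_ge_zero bd[OF x, of y]] by (intro mult_mono) auto
  next
    have *: "(\<lambda>k. K * exp (\<epsilon> n * (s\<^sup>2 - (real k)\<^sup>2))) \<longlonglongrightarrow> 0"
      using \<epsilon>(1)[of n] by real_asymp
    then show "(\<lambda>k. K * exp (\<epsilon> n * (s\<^sup>2 - (real k)\<^sup>2))) \<longlonglongrightarrow> 0" .
    from * show "(\<lambda>k. K * exp (\<epsilon> n * (s\<^sup>2 - (- real k)\<^sup>2))) \<longlonglongrightarrow> 0" by simp
  qed
  show ?thesis
    using lim[OF I1] lim[OF I2] unfolding eq by (rule LIMSEQ_unique)
qed

text \<open>After a shift by \<open>- s\<close>, fixing the real part \<open>x\<close> exhibits the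
  two integrands as values of a single entire function \<open>H x\<close> on the lines with real
  part \<open>s\<close> and \<open>- s\<close>. Shifting the line of integration for almost every
  \<open>x\<close> equates the integrals.\<close>

lemma wco_symmetric_real_translation:
  fixes s :: real
  assumes f: "f \<in> fock" and g: "g \<in> fock" and s: "0 \<le> s"
    and I1: "integrable lborel (\<lambda>z. exp (2 * of_real s * z) * f (z + 2 * of_real s) * cnj (g z) * of_real (exp (- (norm z)\<^sup>2)))"
    and I2: "integrable lborel (\<lambda>z. f z * cnj (exp (2 * of_real s * z) * g (z + 2 * of_real s)) * of_real (exp (- (norm z)\<^sup>2)))"
  shows "(\<integral>z. exp (2 * of_real s * z) * f (z + 2 * of_real s) * cnj (g z) * of_real (exp (- (norm z)\<^sup>2)) \<partial>lborel)
       = (\<integral>z. f z * cnj (exp (2 * of_real s * z) * g (z + 2 * of_real s)) * of_real (exp (- (norm z)\<^sup>2)) \<partial>lborel)"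
    (is "integral\<^sup>L lborel ?F = integral\<^sup>L lborel ?G")
proof -
  define F G where "F = ?F" and "G = ?G"
  have IF: "integrable lborel F" and IG: "integrable lborel G"
    using I1 I2 by (simp_all only: F_def G_def)
  have IF': "integrable lborel (\<lambda>z. F (z + of_real (- s)))"
    by (rule integrable_translation[THEN iffD2]) (use IF in auto)
  have IG': "integrable lborel (\<lambda>z. G (z + of_real (- s)))"
    by (rule integrable_translation[THEN iffD2]) (use IG in auto)
  \<comment> \<open>The inner and outer conjugations make the second factor holomorphic in
    \<open>\<zeta>\<close>. At \<open>Complex s y\<close> the arguments of \<open>f\<close> and
    \<open>g\<close> are \<open>Complex (x + s) y\<close> and \<open>Complex (x - s) y\<close>; at
    \<open>Complex (- s) y\<close> they are interchanged.\<close>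
  define H where "H = (\<lambda>x \<zeta>. f (of_real x + \<zeta>) * cnj (g (cnj (of_real x - \<zeta>))) * exp (\<zeta>\<^sup>2))"
  \<comment> \<open>What remains of the Gaussian and exponential weights once the square of
    \<open>\<zeta>\<close> is split off; it depends on \<open>x\<close> alone and is the same on
    both lines.\<close>
  define k where "k = (\<lambda>x. exp (- (complex_of_real x)\<^sup>2 + 4 * of_real s * of_real x - 4 * (of_real s)\<^sup>2))"
  have F_eq: "F (Complex x y + of_real (- s)) = k x * H x (Complex s y)" for x y
  proof -
    let ?z = "Complex x y"
    have "exp (2 * of_real s * (?z + of_real (- s))) * exp (- ?z * cnj ?z - of_real (- s) * cnj (of_real (- s)) - ?z * cnj (of_real (- s)) - of_real (- s) * cnj ?z)
        = k x * exp ((Complex s y)\<^sup>2)"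
      unfolding k_def mult_exp_exp
      by (rule arg_cong[where f = exp]) (simp add: complex_eq_iff power2_eq_square algebra_simps)
    moreover have "?z + of_real (- s) + 2 * of_real s = of_real x + Complex s y"
      and "cnj (of_real x - Complex s y) = ?z + of_real (- s)"
      by (simp_all add: complex_eq_iff)
    ultimately show ?thesis
      unfolding F_def H_def gaussian_translate[of ?z] by algebra
  qed
  have G_eq: "G (Complex x y + of_real (- s)) = k x * H x (Complex (- s) y)" for x y
  proof -
    let ?z = "Complex x y"
    have "cnj (exp (2 * of_real s * (?z + of_real (- s)))) * exp (- ?z * cnj ?z - of_real (- s) * cnj (of_real (- s)) - ?z * cnj (of_real (- s)) - of_real (- s) * cnj ?z)
        = k x * exp ((Complex (- s) y)\<^sup>2)"
      unfolding k_def mult_exp_exp exp_cnj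
      by (rule arg_cong[where f = exp]) (simp add: complex_eq_iff power2_eq_square algebra_simps)
    moreover have "?z + of_real (- s) = of_real x + Complex (- s) y"
      and "cnj (of_real x - Complex (- s) y) = ?z + of_real (- s) + 2 * of_real s"
      by (simp_all add: complex_eq_iff)
    ultimately show ?thesis
      unfolding G_def H_def gaussian_translate[of ?z] complex_cnj_mult by algebra
  qed
  have H_hol: "H x holomorphic_on UNIV" for x
  proof -
    have "cnj \<circ> g \<circ> cnj holomorphic_on UNIV"
      using fock_entire[OF g] by (intro holomorphic_on_compose_cnj_cnj) (auto intro: holomorphic_on_subset)
    then have "(\<lambda>\<zeta>. (cnj \<circ> g \<circ> cnj) (of_real x - \<zeta>)) holomorphic_on UNIV"
      by (rule entire_compose) (intro holomorphic_intros)
    then have "(\<lambda>\<zeta>. cnj (g (cnj (of_real x - \<zeta>)))) holomorphic_on UNIV"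
      by (simp only: o_def)
    moreover have "(\<lambda>\<zeta>. f (of_real x + \<zeta>)) holomorphic_on UNIV"
      by (rule entire_compose[OF fock_entire[OF f]]) (intro holomorphic_intros)
    ultimately show ?thesis
      unfolding H_def by (intro holomorphic_intros)
  qed
  \<comment> \<open>By the parallelogram law the two pointwise bounds contribute the exponent
    \<open>x\<^sup>2 + u\<^sup>2 + y\<^sup>2\<close>, while the factor
    \<open>exp (\<zeta>\<^sup>2)\<close> contributes \<open>u\<^sup>2 - y\<^sup>2\<close>. The
    growth in \<open>y\<close> cancels exactly, leaving a bound uniform on the strip.\<close>
  have H_bound: "norm (H x (Complex u y)) \<le> fock_norm f * fock_norm g * exp (x\<^sup>2 + 2 * s\<^sup>2)"
    if u: "\<bar>u\<bar> \<le> s" for x u y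
  proof -
    let ?\<zeta> = "Complex u y"
    have "norm (H x ?\<zeta>) = norm (f (of_real x + ?\<zeta>)) * norm (g (cnj (of_real x - ?\<zeta>))) * norm (exp (?\<zeta>\<^sup>2))"
      by (simp add: H_def norm_mult)
    also have "\<dots> \<le> (fock_norm f * exp ((norm (of_real x + ?\<zeta>))\<^sup>2 / 2))
        * (fock_norm g * exp ((norm (cnj (of_real x - ?\<zeta>)))\<^sup>2 / 2)) * norm (exp (?\<zeta>\<^sup>2))"
      by (intro mult_right_mono mult_mono fock_pointwise_bound f g norm_ge_zero
            order_trans[OF norm_ge_zero fock_pointwise_bound[OF f]])
    also have "norm (exp (?\<zeta>\<^sup>2)) = exp (u\<^sup>2 - y\<^sup>2)"
      using norm_exp_square[of 1 u y] by simp
    also have "(fock_norm f * exp ((norm (of_real x + ?\<zeta>))\<^sup>2 / 2))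
        * (fock_norm g * exp ((norm (cnj (of_real x - ?\<zeta>)))\<^sup>2 / 2)) * exp (u\<^sup>2 - y\<^sup>2)
        = fock_norm f * fock_norm g * (exp ((norm (of_real x + ?\<zeta>))\<^sup>2 / 2)
        * exp ((norm (cnj (of_real x - ?\<zeta>)))\<^sup>2 / 2) * exp (u\<^sup>2 - y\<^sup>2))"
      by (simp only: mult_ac)
    also have "exp ((norm (of_real x + ?\<zeta>))\<^sup>2 / 2) * exp ((norm (cnj (of_real x - ?\<zeta>)))\<^sup>2 / 2) * exp (u\<^sup>2 - y\<^sup>2)
        = exp (x\<^sup>2 + 2 * u\<^sup>2)"
      unfolding mult_exp_exp cmod_power2
      by (rule arg_cong[where f = exp]) (simp add: power2_eq_square field_simps)
    also have "fock_norm f * fock_norm g * exp (x\<^sup>2 + 2 * u\<^sup>2) \<le> fock_norm f * fock_norm g * exp (x\<^sup>2 + 2 * s\<^sup>2)"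
      using u s by (intro mult_left_mono mult_nonneg_nonneg fock_norm_nonneg)
        (auto simp: abs_le_square_iff[symmetric])
    finally show ?thesis .
  qed
  have k: "k x \<noteq> 0" for x by (simp add: k_def)
  have cancel: "integrable lborel h" if "integrable lborel (\<lambda>y. k x * h y)" for h :: "real \<Rightarrow> complex" and x
    using Bochner_Integration.integrable_mult_right[OF that, of "inverse (k x)"] k[of x]
    by (simp flip: mult.assoc)
  have "(\<integral>x. \<integral>y. F (Complex x y + of_real (- s)) \<partial>lborel \<partial>lborel)
      = (\<integral>x. \<integral>y. G (Complex x y + of_real (- s)) \<partial>lborel \<partial>lborel)"
  proof (rule integral_cong_AE)
    show "AE x in lborel. (\<integral>y. F (Complex x y + of_real (- s)) \<partial>lborel)
        = (\<integral>y. G (Complex x y + of_real (- s)) \<partial>lborel)"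
      using integral_lborel_complex(1)[OF IF'] integral_lborel_complex(1)[OF IG']
    proof eventually_elim
      case (elim x)
      have "(\<integral>y. H x (Complex s y) \<partial>lborel) = (\<integral>y. H x (Complex (- s) y) \<partial>lborel)"
        by (rule vertical_line_shift_bounded[OF H_hol s H_bound
              cancel[OF elim(1)[unfolded F_eq]] cancel[OF elim(2)[unfolded G_eq]]])
      then show ?case
        unfolding F_eq G_eq by simp
    qed
  qed (use integral_lborel_complex(2)[OF IF'] integral_lborel_complex(2)[OF IG'] in auto)
  then have "(\<integral>z. F (z + of_real (- s)) \<partial>lborel) = (\<integral>z. G (z + of_real (- s)) \<partial>lborel)"
    by (simp only: integral_lborel_complex(3)[OF IF'] integral_lborel_complex(3)[OF IG'])
  then have "integral\<^sup>L lborel F = integral\<^sup>L lborel G"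
    by (subst (asm) (1 2) integral_translation) (use IF IG in auto)
  then show ?thesis
    by (simp only: F_def G_def)
qed

section \<open>Rotations, and translations in arbitrary directions\<close>

lemma fock_rotate:
  assumes "f \<in> fock" and "norm \<beta> = 1"
  shows "(\<lambda>z. f (\<beta> * z)) \<in> fock"
proof -
  let ?F = "\<lambda>z. (norm (f z))\<^sup>2 * exp (- (norm z)\<^sup>2)"
  have [measurable]: "f \<in> borel_measurable borel"
    using assms(1) by (rule fock_measurable)
  have "integrable lborel (\<lambda>z. ?F (\<beta> * z))"
    using assms by (subst integrable_rotation) (auto simp: fock_iff)
  moreover have "(\<lambda>z. f (\<beta> * z)) holomorphic_on UNIV"
    by (rule entire_compose[OF fock_entire[OF assms(1)]]) (intro holomorphic_intros)
  ultimately show ?thesis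
    using assms(2) by (simp add: fock_iff norm_mult)
qed

text \<open>A rotation in the direction of \<open>B\<close> reduces to a real non-negative
  translation; area, Gaussian and Fock space are all rotation invariant.\<close>

lemma wco_symmetric_translation:
  fixes B :: complex
  assumes f: "f \<in> fock" and g: "g \<in> fock"
    and I1: "integrable lborel (\<lambda>z. exp (cnj B * z) * f (z + B) * cnj (g z) * of_real (exp (- (norm z)\<^sup>2)))"
    and I2: "integrable lborel (\<lambda>z. f z * cnj (exp (cnj B * z) * g (z + B)) * of_real (exp (- (norm z)\<^sup>2)))"
  shows "(\<integral>z. exp (cnj B * z) * f (z + B) * cnj (g z) * of_real (exp (- (norm z)\<^sup>2)) \<partial>lborel)
       = (\<integral>z. f z * cnj (exp (cnj B * z) * g (z + B)) * of_real (exp (- (norm z)\<^sup>2)) \<partial>lborel)"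
    (is "integral\<^sup>L lborel ?F = integral\<^sup>L lborel ?G")
proof -
  define s where "s = norm B / 2"
  \<comment> \<open>The value 1 at \<open>B = 0\<close> replaces \<open>sgn 0 = 0\<close>, which
    does not have modulus 1.\<close>
  define \<beta> where "\<beta> = (if B = 0 then 1 else sgn B)"
  have \<beta>: "norm \<beta> = 1" by (simp add: \<beta>_def norm_sgn)
  have B: "B = \<beta> * (2 * of_real s)"
    by (simp add: \<beta>_def s_def sgn_div_norm scaleR_conv_of_real)
  have "cnj \<beta> * \<beta> = 1"
    using \<beta> complex_norm_square[of \<beta>] by (simp add: mult.commute)
  then have B': "cnj B * (\<beta> * z) = 2 * of_real s * z" for z
    unfolding B by (simp add: algebra_simps)
  define F G where "F = ?F" and "G = ?G"
  have IF: "integrable lborel F" and IG: "integrable lborel G"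
    using I1 I2 by (simp_all only: F_def G_def)
  let ?f = "\<lambda>z. f (\<beta> * z)" and ?g = "\<lambda>z. g (\<beta> * z)"
  have arg: "\<beta> * z + B = \<beta> * (z + 2 * of_real s)" for z
    by (simp add: B algebra_simps)
  have nrm: "norm (\<beta> * z) = norm z" for z
    by (simp add: norm_mult \<beta>)
  have F: "F (\<beta> * z) = exp (2 * of_real s * z) * ?f (z + 2 * of_real s) * cnj (?g z) * of_real (exp (- (norm z)\<^sup>2))" for z
    unfolding F_def by (simp only: B' arg nrm)
  have G: "G (\<beta> * z) = ?f z * cnj (exp (2 * of_real s * z) * ?g (z + 2 * of_real s)) * of_real (exp (- (norm z)\<^sup>2))" for z
    unfolding G_def by (simp only: B' arg nrm)
  have IF': "integrable lborel (\<lambda>z. F (\<beta> * z))" and IG': "integrable lborel (\<lambda>z. G (\<beta> * z))"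
    using IF IG \<beta> by (simp_all add: integrable_rotation)
  have "(\<integral>z. F (\<beta> * z) \<partial>lborel) = (\<integral>z. G (\<beta> * z) \<partial>lborel)"
    unfolding F G
    by (rule wco_symmetric_real_translation[OF fock_rotate[OF f \<beta>] fock_rotate[OF g \<beta>] _ IF'[unfolded F] IG'[unfolded G]])
       (simp add: s_def)
  then have "integral\<^sup>L lborel F = integral\<^sup>L lborel G"
    using IF IG \<beta> by (simp add: integral_rotation)
  then show ?thesis
    by (simp only: F_def G_def)
qed

section \<open>Hermitian weighted composition operators\<close>

lemma fock_inner_scale_right: "fock_inner f (\<lambda>z. c * g z) = cnj c * fock_inner f g"
  using fock_inner_cnj[of f "\<lambda>z. c * g z"] fock_inner_cnj[of f g] by (simp add: fock_inner_scale_left)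

text \<open>The affine map has a fixed point when \<open>A \<noteq> 1\<close> and is a translation
  when \<open>A = 1\<close>; the two symmetry results cover these cases on the whole maximal
  domain.\<close>

lemma wco_expr_symmetric:
  fixes A C :: real and B :: complex
  assumes C: "C \<noteq> 0" and \<phi>: "\<And>z. \<phi> z = of_real A * z + B" and \<psi>: "\<And>z. \<psi> z = of_real C * exp (cnj B * z)"
    and f: "f \<in> fock" "wco_expr \<psi> \<phi> f \<in> fock" and g: "g \<in> fock" "wco_expr \<psi> \<phi> g \<in> fock"
  shows "fock_inner (wco_expr \<psi> \<phi> f) g = fock_inner f (wco_expr \<psi> \<phi> g)"
proof (cases "A = 1")
  case False
  then show ?thesis
    using wco_symmetric_fixed_point[OF fock_entire[OF f(1)] fock_entire[OF g(1)] False C, of B]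
      fock_inner_integrable[OF f(2) g(1)] fock_inner_integrable[OF f(1) g(2)]
    unfolding fock_inner_def wco_expr_def \<phi> \<psi> by (simp only:)
next
  case True
  \<comment> \<open>The translation result is stated without the factor \<open>C\<close>, which is
    therefore split off; being real, it can be moved across the inner product.\<close>
  define E where "E = (\<lambda>f z. exp (cnj B * z) * f (z + B))"
  have E: "wco_expr \<psi> \<phi> h = (\<lambda>z. of_real C * E h z)" for h
    by (simp add: wco_expr_def E_def \<phi> \<psi> True mult.assoc)
  have E_fock: "E h \<in> fock" if "wco_expr \<psi> \<phi> h \<in> fock" for h
    using fock_scale[OF that[unfolded E], of "1 / of_real C"] C by simp
  have "fock_inner (E f) g = fock_inner f (E g)"
    using wco_symmetric_translation[OF f(1) g(1), of B]
      fock_inner_integrable[OF E_fock[OF f(2)] g(1)] fock_inner_integrable[OF f(1) E_fock[OF g(2)]]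
    unfolding fock_inner_def E_def by (simp only:)
  then show ?thesis
    unfolding E fock_inner_scale_left fock_inner_scale_right by simp
qed

section \<open>Linearity, adjoints, closedness and density\<close>

lemma unbounded_wco_linear:
  assumes "unbounded_wco \<psi> \<phi> W"
  shows "linear_fock_op W"
proof -
  obtain D where D: "fun_subspace D" "D \<subseteq> Domain (wco_max \<psi> \<phi>)" "W = wco_max \<psi> \<phi> \<inter> (D \<times> UNIV)"
    using assms by (auto simp: unbounded_wco_def)
  have W: "(f, f') \<in> W \<longleftrightarrow> f \<in> D \<and> f' = wco_expr \<psi> \<phi> f" for f f'
    using D by (auto simp: wco_max_def)
  have fock: "f \<in> fock \<and> wco_expr \<psi> \<phi> f \<in> fock" if "f \<in> D" for f
    using D that by (auto simp: wco_max_def)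
  have dom: "Domain W = D"
    using W by auto
  have "W \<subseteq> fock \<times> fock" "single_valued W"
    using W fock by (auto simp: single_valued_def)
  then show ?thesis
    using D(1) unfolding linear_fock_op_def dom W fun_subspace_def
    by (auto simp: wco_expr_def fun_eq_iff algebra_simps)
qed

lemma unbounded_wcoD:
  assumes "unbounded_wco \<psi> \<phi> W" "(f, f') \<in> W"
  shows "f \<in> fock" "f' = wco_expr \<psi> \<phi> f" "wco_expr \<psi> \<phi> f \<in> fock"
  using assms by (auto simp: unbounded_wco_def wco_max_def)

text \<open>Pairing \<open>wco_expr \<psi> \<phi> f\<close> with the kernel at \<open>w\<close>
  gives \<open>\<psi> w * f (\<phi> w)\<close>, and this is again a pairing of \<open>f\<close> with
  a multiple of the kernel at \<open>\<phi> w\<close>.\<close>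

lemma kernel_mem_adjoint:
  assumes "unbounded_wco \<psi> \<phi> W"
  shows "(fock_kernel w, \<lambda>z. cnj (\<psi> w) * fock_kernel (\<phi> w) z) \<in> adjoint_op W"
  using unbounded_wcoD[OF assms]
  by (auto simp: adjoint_op_def fock_kernel_fock fock_scale fock_inner_scale_right fock_reproducing)
     (auto simp: wco_expr_def)

text \<open>The hypothesis puts all kernels into the maximal domain. Testing the adjoint relation on
  them evaluates \<open>h\<close> pointwise and identifies it as
  \<open>wco_expr \<psi> \<phi> g\<close>.\<close>

lemma wco_max_adjoint_subset:
  assumes "\<And>w. wco_expr \<psi> \<phi> (fock_kernel w) = (\<lambda>z. cnj (\<psi> w) * fock_kernel (\<phi> w) z)"
  shows "adjoint_op (wco_max \<psi> \<phi>) \<subseteq> wco_max \<psi> \<phi>"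
proof (rule subrelI)
  fix g h assume "(g, h) \<in> adjoint_op (wco_max \<psi> \<phi>)"
  then have g: "g \<in> fock" and h: "h \<in> fock"
    and *: "\<And>f f'. (f, f') \<in> wco_max \<psi> \<phi> \<Longrightarrow> fock_inner f' g = fock_inner f h"
    by (auto simp: adjoint_op_def)
  have "h w = \<psi> w * g (\<phi> w)" for w
  proof -
    have "(fock_kernel w, \<lambda>z. cnj (\<psi> w) * fock_kernel (\<phi> w) z) \<in> wco_max \<psi> \<phi>"
      using assms[of w] fock_kernel_fock by (force simp: wco_max_def intro: fock_scale)
    from *[OF this] have "cnj (\<psi> w) * fock_inner (fock_kernel (\<phi> w)) g = fock_inner (fock_kernel w) h"
      by (simp add: fock_inner_scale_left)
    then have "cnj (\<psi> w * g (\<phi> w)) = cnj (h w)"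
      using fock_reproducing[OF g, of "\<phi> w"] fock_reproducing[OF h, of w]
      by (simp add: fock_inner_cnj[of "fock_kernel w" h] fock_inner_cnj[of "fock_kernel (\<phi> w)" g])
    then show ?thesis
      using complex_cnj_cancel_iff by metis
  qed
  then have "h = wco_expr \<psi> \<phi> g"
    by (auto simp: wco_expr_def)
  then show "(g, h) \<in> wco_max \<psi> \<phi>"
    using g h by (auto simp: wco_max_def)
qed

lemma fock_norm_tendsto_imp_pointwise:
  assumes "\<And>n. u n \<in> fock" "f \<in> fock" "(\<lambda>n. fock_norm (\<lambda>z. u n z - f z)) \<longlonglongrightarrow> 0"
  shows "(\<lambda>n. u n w) \<longlonglongrightarrow> f w"
proof -
  have "(\<lambda>n. u n w - f w) \<longlonglongrightarrow> 0"
  proof (rule Lim_null_comparison[OF always_eventually, rule_format])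
    show "norm (u n w - f w) \<le> fock_norm (\<lambda>z. u n z - f z) * exp ((norm w)\<^sup>2 / 2)" for n
      using fock_pointwise_bound[OF fock_diff[OF assms(1,2)]] by blast
    show "(\<lambda>n. fock_norm (\<lambda>z. u n z - f z) * exp ((norm w)\<^sup>2 / 2)) \<longlonglongrightarrow> 0"
      using tendsto_mult_right[OF assms(3), of "exp ((norm w)\<^sup>2 / 2)"] by (simp add: mult.commute)
  qed
  then show ?thesis
    by (rule LIM_zero_cancel)
qed

text \<open>Norm convergence implies pointwise convergence, which identifies the limit of the
  images; maximality of the domain then places the limit pair in the graph.\<close>

lemma closed_wco_max: "closed_op (wco_max \<psi> \<phi>)"
  unfolding closed_op_def
proof (intro allI impI)
  fix u v f g
  assume uv: "\<forall>n::nat. (u n, v n) \<in> wco_max \<psi> \<phi>" and f: "f \<in> fock" and g: "g \<in> fock"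
    and lu: "(\<lambda>n. fock_norm (\<lambda>z. u n z - f z)) \<longlonglongrightarrow> 0"
    and lv: "(\<lambda>n. fock_norm (\<lambda>z. v n z - g z)) \<longlonglongrightarrow> 0"
  have u: "u n \<in> fock" and v: "v n \<in> fock" and v_eq: "v n = wco_expr \<psi> \<phi> (u n)" for n
    using uv by (auto simp: wco_max_def)
  have "g w = \<psi> w * f (\<phi> w)" for w
  proof (rule LIMSEQ_unique)
    show "(\<lambda>n. v n w) \<longlonglongrightarrow> g w"
      by (rule fock_norm_tendsto_imp_pointwise[OF v g lv])
    show "(\<lambda>n. v n w) \<longlonglongrightarrow> \<psi> w * f (\<phi> w)"
      unfolding v_eq wco_expr_def
      by (intro tendsto_mult_left fock_norm_tendsto_imp_pointwise[OF u f lu])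
  qed
  then have "g = wco_expr \<psi> \<phi> f"
    by (auto simp: wco_expr_def)
  then show "(f, g) \<in> wco_max \<psi> \<phi>"
    using f g by (auto simp: wco_max_def)
qed

text \<open>Taylor polynomials approximate \<open>f\<close> in norm, and they lie in the domain
  because affine substitution and an exponential weight keep the growth at most exponential.\<close>

lemma densely_defined_wco_max:
  fixes A C :: real and B :: complex
  assumes \<phi>: "\<And>z. \<phi> z = of_real A * z + B" and \<psi>: "\<And>z. \<psi> z = of_real C * exp (cnj B * z)"
  shows "densely_defined (wco_max \<psi> \<phi>)"
  unfolding densely_defined_def
proof (intro ballI allI impI)
  fix f and e :: real assume f: "f \<in> fock" and e: "0 < e"
  define a where "a = (\<lambda>n. (deriv ^^ n) f 0 / fact n)"
  have "(\<lambda>n. a n * z ^ n) sums f z" for z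
    unfolding a_def by (rule entire_powser[OF fock_entire[OF f]])
  from order_tendstoD(2)[OF fock_taylor_converges[OF f this] e]
  obtain N where "fock_norm (\<lambda>z. f z - (\<Sum>n<N. a n * z ^ n)) < e"
    by (auto simp: eventually_sequentially)
  moreover define S where "S = (\<lambda>z. \<Sum>n<N. a n * z ^ n)"
  moreover have "S \<in> Domain (wco_max \<psi> \<phi>)"
  proof -
    define M where "M = (\<Sum>n<N. norm (a n) * fact n)"
    have M: "0 \<le> M" by (auto simp: M_def intro!: sum_nonneg)
    have bd: "norm (S z) \<le> M * exp (norm z)" for z
      unfolding S_def M_def by (rule polynomial_exp_bound)
    have hol: "S holomorphic_on UNIV"
      unfolding S_def by (intro holomorphic_intros)
    have "S \<in> fock"
      by (rule fock_exponential_typeI[where c = 1]) (use hol bd in auto)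
    moreover have "wco_expr \<psi> \<phi> S \<in> fock"
    \<comment> \<open>In the rate, \<open>norm B\<close> comes from the weight and
      \<open>\<bar>A\<bar>\<close> from the dilated argument; the shift by \<open>B\<close> accounts
      for \<open>exp (norm B)\<close> in the constant.\<close>
    proof (rule fock_exponential_typeI[where c = "norm B + \<bar>A\<bar>" and M = "\<bar>C\<bar> * M * exp (norm B)"])
      have "(\<lambda>z. S (of_real A * z + B)) holomorphic_on UNIV"
        by (rule entire_compose[OF hol]) (intro holomorphic_intros)
      then show "wco_expr \<psi> \<phi> S holomorphic_on UNIV"
        unfolding wco_expr_def \<phi> \<psi> by (intro holomorphic_intros)
      show "norm (wco_expr \<psi> \<phi> S z) \<le> \<bar>C\<bar> * M * exp (norm B) * exp ((norm B + \<bar>A\<bar>) * norm z)" for z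
      proof -
        have 1: "norm (exp (cnj B * z)) \<le> exp (norm B * norm z)"
          using norm_exp[of "cnj B * z"] by (simp add: norm_mult)
        have "norm (of_real A * z + B) \<le> \<bar>A\<bar> * norm z + norm B"
          using norm_triangle_ineq[of "of_real A * z" B] by (simp add: norm_mult)
        then have 2: "norm (S (of_real A * z + B)) \<le> M * exp (\<bar>A\<bar> * norm z + norm B)"
          using bd[of "of_real A * z + B"] M by (meson exp_le_cancel_iff mult_left_mono order_trans)
        have "norm (wco_expr \<psi> \<phi> S z) = \<bar>C\<bar> * (norm (exp (cnj B * z)) * norm (S (of_real A * z + B)))"
          by (simp add: wco_expr_def \<phi> \<psi> norm_mult)
        also have "\<dots> \<le> \<bar>C\<bar> * (exp (norm B * norm z) * (M * exp (\<bar>A\<bar> * norm z + norm B)))"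
          using 1 2 by (intro mult_left_mono mult_mono) auto
        also have "\<dots> = \<bar>C\<bar> * M * exp (norm B) * exp ((norm B + \<bar>A\<bar>) * norm z)"
          by (simp add: exp_add distrib_right)
        finally show ?thesis .
      qed
    qed simp
    ultimately show ?thesis
      by (auto simp: wco_max_def)
  qed
  ultimately show "\<exists>g\<in>Domain (wco_max \<psi> \<phi>). fock_norm (\<lambda>z. f z - g z) < e"
    by (intro bexI[of _ S]) simp_all
qed

text \<open>Setting \<open>w = 0\<close> determines \<psi>. Cancelling it leaves an identity of
  exponentials, and a continuity argument upgrades this to an identity of exponents, from which
  \<phi> is affine with real slope.\<close>

lemma wco_kernel_identity_imp_form:
  assumes hol: "\<phi> holomorphic_on UNIV" and nz: "\<exists>z. \<psi> z \<noteq> 0"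
    and ker: "\<And>z w. \<psi> z * exp (cnj w * \<phi> z) = cnj (\<psi> w) * exp (cnj (\<phi> w) * z)"
  shows "\<exists>(A::real) (C::real) (B::complex). C \<noteq> 0 \<and>
       (\<forall>z. \<phi> z = of_real A * z + B) \<and> (\<forall>z. \<psi> z = of_real C * exp (cnj B * z))"
proof -
  define B where "B = \<phi> 0"
  have "\<psi> 0 = cnj (\<psi> 0)" using ker[of 0 0] by simp
  then have "\<psi> 0 \<in> \<real>" by (metis Reals_cnj_iff)
  then obtain C where C: "\<psi> 0 = of_real C" by (auto elim: Reals_cases)
  have \<psi>: "\<psi> z = of_real C * exp (cnj B * z)" for z
    using ker[of z 0] by (simp add: C B_def)
  have C0: "C \<noteq> 0" using nz \<psi> by auto
  have lin: "cnj w * (\<phi> z - B) = z * cnj (\<phi> w - B)" for w z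
  proof -
    \<comment> \<open>The difference of the two exponents, for fixed \<open>w\<close>. Its values
      are integer multiples of \<open>2 * pi * \<i>\<close>, so continuity makes it constant, and it
      vanishes at 0 since \<open>\<phi> 0 = B\<close>.\<close>
    define q where "q = (\<lambda>z. cnj B * z + cnj w * \<phi> z - (B * cnj w + cnj (\<phi> w) * z))"
    have "exp (q z) = 1" for z
    proof -
      have "exp (cnj B * z + cnj w * \<phi> z) = exp (B * cnj w + cnj (\<phi> w) * z)"
        using ker[of z w] C0 by (simp add: \<psi> exp_add exp_cnj)
      then show ?thesis
        unfolding q_def exp_diff by simp
    qed
    then have q: "\<exists>n::int. q z = of_real (of_int (2 * n) * pi) * \<i>" for z
      using exp_eq_1[of "q z"] by (auto simp: complex_eq_iff)
    have "q constant_on UNIV"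
    proof (rule continuous_discrete_range_constant)
      show "continuous_on UNIV q"
        unfolding q_def using holomorphic_on_imp_continuous_on[OF hol] by (intro continuous_intros)
      show "\<exists>e>0. \<forall>y. y \<in> UNIV \<and> q y \<noteq> q x \<longrightarrow> e \<le> norm (q y - q x)" if "x \<in> UNIV" for x
      proof (intro exI conjI allI impI)
        fix y assume y: "y \<in> UNIV \<and> q y \<noteq> q x"
        obtain m n :: int where mn: "q y = of_real (of_int (2 * m) * pi) * \<i>" "q x = of_real (of_int (2 * n) * pi) * \<i>"
          using q by meson
        have "m \<noteq> n" using y mn by auto
        then have "1 \<le> \<bar>real_of_int (m - n)\<bar>" by linarith
        then have "2 * pi * 1 \<le> 2 * pi * \<bar>real_of_int (m - n)\<bar>"
          by (intro mult_left_mono) auto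
        also have "\<dots> = norm (complex_of_real (2 * pi * real_of_int (m - n)) * \<i>)"
          by (simp add: norm_mult abs_mult del: of_int_diff)
        also have "complex_of_real (2 * pi * real_of_int (m - n)) * \<i> = q y - q x"
          by (simp add: mn algebra_simps)
        finally show "2 * pi \<le> norm (q y - q x)" by simp
      qed simp
    qed (rule connected_UNIV)
    then have "q z = q 0"
      unfolding constant_on_def by auto
    also have "q 0 = 0"
      by (simp add: q_def B_def mult.commute)
    finally show ?thesis
      by (simp add: q_def algebra_simps)
  qed
  \<comment> \<open>The prospective slope: \<open>lin\<close> with \<open>w = 1\<close> reads
    \<open>\<phi> z - B = z * \<alpha>\<close>, and \<open>z = 1\<close> as well shows that \<alpha>
    equals its conjugate.\<close>
  define \<alpha> where "\<alpha> = cnj (\<phi> 1 - B)"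
  have "\<alpha> = cnj \<alpha>"
    using lin[of 1 1] by (simp add: \<alpha>_def)
  then have "\<alpha> \<in> \<real>" by (metis Reals_cnj_iff)
  then obtain A where A: "\<alpha> = of_real A" by (auto elim: Reals_cases)
  have "\<phi> z = of_real A * z + B" for z
    using lin[of 1 z] unfolding A[symmetric] \<alpha>_def by (simp add: algebra_simps)
  with C0 \<psi> show ?thesis by blast
qed

theorem theorem5p3:
  fixes \<psi> \<phi> :: "complex \<Rightarrow> complex" and W :: fock_op
  assumes "\<psi> holomorphic_on UNIV" and "\<phi> holomorphic_on UNIV"
    and "\<exists>z. \<psi> z \<noteq> 0"
    and "unbounded_wco \<psi> \<phi> W"
  shows "hermitian_op W \<longleftrightarrow>
    W = wco_max \<psi> \<phi> \<and>
    (\<exists>(A::real) (C::real) (B::complex). C \<noteq> 0 \<and>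
       (\<forall>z. \<phi> z = of_real A * z + B) \<and>
       (\<forall>z. \<psi> z = of_real C * exp (cnj B * z)))"
proof
  assume herm: "hermitian_op W"
  then have WW: "W = adjoint_op W" by (simp add: hermitian_op_def)
  have W_sub: "W \<subseteq> wco_max \<psi> \<phi>"
    using assms(4) by (auto simp: unbounded_wco_def)
  have "\<psi> z * exp (cnj w * \<phi> z) = cnj (\<psi> w) * exp (cnj (\<phi> w) * z)" for z w
  proof -
    \<comment> \<open>Self-adjointness moves the kernels from the domain of the adjoint into that of
      \<open>W\<close>, where the image is also given by \<open>wco_expr\<close>; equating the two
      images is the kernel identity.\<close>
    have "(fock_kernel w, \<lambda>z. cnj (\<psi> w) * fock_kernel (\<phi> w) z) \<in> W"
      using kernel_mem_adjoint[OF assms(4)] WW by simp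
    from unbounded_wcoD(2)[OF assms(4) this] show ?thesis
      by (auto simp: wco_expr_def fock_kernel_def fun_eq_iff)
  qed
  from wco_kernel_identity_imp_form[OF assms(2,3) this]
  obtain A C :: real and B :: complex where C: "C \<noteq> 0" and \<phi>: "\<And>z. \<phi> z = of_real A * z + B"
    and \<psi>: "\<And>z. \<psi> z = of_real C * exp (cnj B * z)"
    by blast
  \<comment> \<open>Symmetry on the maximal domain pairs every element of \<open>wco_max\<close>
    with all of \<open>W\<close>; since \<open>W\<close> is its own adjoint, it cannot be a proper
    restriction.\<close>
  have "wco_max \<psi> \<phi> \<subseteq> adjoint_op W"
    using W_sub wco_expr_symmetric[OF C \<phi> \<psi>] by (fastforce simp: adjoint_op_def wco_max_def)
  with WW W_sub have "W = wco_max \<psi> \<phi>" by auto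
  with C \<phi> \<psi> show "W = wco_max \<psi> \<phi> \<and> (\<exists>(A::real) (C::real) (B::complex). C \<noteq> 0 \<and>
       (\<forall>z. \<phi> z = of_real A * z + B) \<and> (\<forall>z. \<psi> z = of_real C * exp (cnj B * z)))"
    by blast
next
  assume "W = wco_max \<psi> \<phi> \<and> (\<exists>(A::real) (C::real) (B::complex). C \<noteq> 0 \<and>
       (\<forall>z. \<phi> z = of_real A * z + B) \<and> (\<forall>z. \<psi> z = of_real C * exp (cnj B * z)))"
  then obtain A C :: real and B :: complex where W: "W = wco_max \<psi> \<phi>" and C: "C \<noteq> 0"
    and \<phi>: "\<And>z. \<phi> z = of_real A * z + B" and \<psi>: "\<And>z. \<psi> z = of_real C * exp (cnj B * z)"
    by blast
  \<comment> \<open>With the explicit forms, both sides have the exponent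
    \<open>cnj B * z + A * cnj w * z + B * cnj w\<close>; real \<open>A\<close> and \<open>C\<close>
    make the coefficients agree.\<close>
  have ker: "wco_expr \<psi> \<phi> (fock_kernel w) = (\<lambda>z. cnj (\<psi> w) * fock_kernel (\<phi> w) z)" for w
  proof
    fix z
    have "exp (cnj B * z) * exp (cnj w * (of_real A * z + B))
        = cnj (exp (cnj B * w)) * exp (cnj (of_real A * w + B) * z)"
      unfolding exp_cnj mult_exp_exp by (rule arg_cong[where f = exp]) (simp add: algebra_simps)
    then show "wco_expr \<psi> \<phi> (fock_kernel w) z = cnj (\<psi> w) * fock_kernel (\<phi> w) z"
      by (simp add: wco_expr_def fock_kernel_def \<phi> \<psi>)
  qed
  have "wco_max \<psi> \<phi> \<subseteq> adjoint_op (wco_max \<psi> \<phi>)"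
    using wco_expr_symmetric[OF C \<phi> \<psi>] by (auto simp: adjoint_op_def wco_max_def)
  with wco_max_adjoint_subset[OF ker] have "wco_max \<psi> \<phi> = adjoint_op (wco_max \<psi> \<phi>)"
    by auto
  then show "hermitian_op W"
    using unbounded_wco_linear[OF assms(4)] closed_wco_max densely_defined_wco_max[OF \<phi> \<psi>]
    by (simp add: hermitian_op_def W)
qed

end
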